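(* For every integer $n\geqslant 1$, $$\sum_{\sigma\in \mathcal{Q}_{n+1}^{(1)}}x^{\operatorname{pap}(\sigma)}y^{\operatorname{cap}(\sigma)}s^{\operatorname{impap}(\sigma)}t^{\operatorname{bk}_2(\sigma)}p^{{\rm even}(\sigma)}q^{\operatorname{tr}(\sigma)} =\sum_{\pi\in \mathfrak{S}_n^B}x^{{\rm exc}(\pi)}y^{{\rm aexc}(\pi)}s^{{\rm single}(\pi)}t^{{\rm fix}(\pi)}p^{{\rm neg}(\pi)}q^{{\rm cyc}(\pi)},$$ where for $\sigma\in\mathcal{Q}_{n+1}^{(1)}$ we set $\operatorname{cap}(\sigma)=n-\operatorname{pap}(\sigma)-\operatorname{impap}(\sigma)-\operatorname{bk}_2(\sigma)$.
   Context: Stirling side. A Stirling permutation of a multiset is a word using each element with its multiplicity such that for each value $i$ all letters between two occurrences of $i$ are at least $i$. For $m\geqslant 1$, $\mathcal{Q}_m^{(1)}$ is the set of Stirling permutations of $\{1,2,2,3,3,\ldots,m,m\}$; such words have length $L=2m-1$. For $\sigma=\sigma_1\cdots\sigma_L$ put $\sigma_0=\sigma_{L+1}=0$. The set of ascent-plateaux is $\operatorname{Ap}(\sigma)=\{\sigma_i: 2\leqslant i\leqslant L-1,\ \sigma_{i-1}<\sigma_i=\sigma_{i+1}\}$. A right-to-left minimum is a letter $\sigma_i$ which is the first occurrence (from the left) of its value and satisfies $\sigma_i\leqslant\sigma_j$ for all $j\in\{i+1,\ldots,L\}$; $\operatorname{Rlmin}(\sigma)$ is the set of their values. Improper ascent-plateaux: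 $\operatorname{Impap}(\sigma)=\operatorname{Ap}(\sigma)\cap\operatorname{Rlmin}(\sigma)$; proper ascent-plateaux: $\operatorname{Pap}(\sigma)=\operatorname{Ap}(\sigma)\setminus\operatorname{Rlmin}(\sigma)$; $\operatorname{impap},\operatorname{pap}$ are their cardinalities. A left-to-right minimum is a letter $\sigma_i$ with $i=1$ or $\sigma_i<\sigma_j$ for all $j<i$. The blocks of $\sigma$ are the maximal consecutive factors that begin with a left-to-right minimum and contain no other left-to-right minimum; $\operatorname{bk}_2(\sigma)$ is the number of blocks of size exactly $2$ (such a block consists of two equal letters). ${\rm even}(\sigma)$ is the number of values whose first occurrence (reading left to right) is at an even position. For $2\leqslant k\leqslant m$, let $\sigma|_k\in\mathcal{Q}_k^{(1)}$ be the subword of $\sigma$ formed by the letters $\leqslant k$. $\operatorname{Trace}(\sigma)$ is the set of values $v$ such that for some $k\in\{2,\ldots,m\}$, either $v\in\operatorname{Impap}(\sigma|_k)$ or $v$ is the second entry of a block of size exactly $2$ of $\sigma|_k$; $\operatorname{tr}(\sigma)=\#\operatorname{Trace}(\sigma)$. (Example: for $\sigma=884554122377366$, $\operatorname{Pap}=\{5,7\}$, $\operatorname{Impap}=\{2,6\}$, $\operatorname{Trace}=\{2,3,4,6,8\}$.) Signed side. $\mathfrak{S}_n^B$ is the set of signed permutations: bijections $\pi$ of $\{\pm1,\ldots,\pm n\}$ with $\pi(-i)=-\pi(i)$, written $\pi(1)\cdots\pi(n)$. Its cycles are the cycles of the permutation $i\mapsto|\pi(i)|$ of $[n]$ (with letters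 $\pi(i)$ written with their signs), and ${\rm cyc}(\pi)$ is their number. ${\rm exc}(\pi)=\#\{i\in[n]:\pi(|\pi(i)|)>\pi(i)\}$, ${\rm aexc}(\pi)=\#\{i\in[n]:\pi(|\pi(i)|)<\pi(i)\}$, ${\rm fix}(\pi)=\#\{i:\pi(i)=i\}$, ${\rm single}(\pi)=\#\{i:\pi(i)=-i\}$, ${\rm neg}(\pi)=\#\{i:\pi(i)<0\}$. *)

theory Defs
  imports "HOL-Combinatorics.Combinatorics"
begin

section \<open>Stirling permutations\<close>

text \<open>
  Words are lists over \<open>nat\<close>. The function \<open>letter\<close> converts to positions
  counted from 1, with the boundary convention that positions outside the word carry 0.
\<close>

definition letter :: "nat list \<Rightarrow> nat \<Rightarrow> nat" where
  "letter w i = (if 1 \<le> i \<and> i \<le> length w then w ! (i - 1) else 0)"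

definition stirling_perms :: "nat multiset \<Rightarrow> nat list set" where
  "stirling_perms M = {w \<in> permutations_of_multiset M.
     \<forall>i j k. 1 \<le> i \<and> i < j \<and> j < k \<and> k \<le> length w \<and> letter w i = letter w k
       \<longrightarrow> letter w i \<le> letter w j}"

definition Q1 :: "nat \<Rightarrow> nat list set" where
  "Q1 m = stirling_perms ({#1#} + (\<Sum>i\<in>{2..m}. {#i, i#}))"

definition Ap :: "nat list \<Rightarrow> nat set" where
  "Ap w = {letter w i | i. i \<in> {2..length w - 1}
             \<and> letter w (i - 1) < letter w i \<and> letter w i = letter w (i + 1)}"

definition first_occ :: "nat list \<Rightarrow> nat \<Rightarrow> bool" where
  "first_occ w i \<longleftrightarrow> i \<in> {1..length w} \<and> (\<forall>j\<in>{1..<i}. letter w j \<noteq> letter w i)"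

definition Rlmin :: "nat list \<Rightarrow> nat set" where
  "Rlmin w = {letter w i | i. i \<in> {1..length w} \<and> first_occ w i
                \<and> (\<forall>j\<in>{i + 1..length w}. letter w i \<le> letter w j)}"

definition Impap :: "nat list \<Rightarrow> nat set" where
  "Impap w = Ap w \<inter> Rlmin w"

definition Pap :: "nat list \<Rightarrow> nat set" where
  "Pap w = Ap w - Rlmin w"

definition impap :: "nat list \<Rightarrow> nat" where
  "impap w = card (Impap w)"

definition pap :: "nat list \<Rightarrow> nat" where
  "pap w = card (Pap w)"

definition lrmin_positions :: "nat list \<Rightarrow> nat set" where
  "lrmin_positions w = {i \<in> {1..length w}. i = 1 \<or> (\<forall>j\<in>{1..<i}. letter w i < letter w j)}"

text \<open>A consecutive factor is represented by its first and last position.\<close>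

definition lrmin_factor :: "nat list \<Rightarrow> nat \<Rightarrow> nat \<Rightarrow> bool" where
  "lrmin_factor w i j \<longleftrightarrow> 1 \<le> i \<and> i \<le> j \<and> j \<le> length w \<and> {i..j} \<inter> lrmin_positions w = {i}"

definition blocks :: "nat list \<Rightarrow> (nat \<times> nat) set" where
  "blocks w = {(i, j). lrmin_factor w i j
     \<and> (\<forall>i' j'. lrmin_factor w i' j' \<and> {i..j} \<subseteq> {i'..j'} \<longrightarrow> {i..j} = {i'..j'})}"

definition blocks2 :: "nat list \<Rightarrow> (nat \<times> nat) set" where
  "blocks2 w = {(i, j) \<in> blocks w. card {i..j} = 2}"

definition bk2 :: "nat list \<Rightarrow> nat" where
  "bk2 w = card (blocks2 w)"

definition even_stat :: "nat list \<Rightarrow> nat" where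
  "even_stat w = card {v. \<exists>i. first_occ w i \<and> letter w i = v \<and> even i}"

definition restrict_word :: "nat list \<Rightarrow> nat \<Rightarrow> nat list" where
  "restrict_word w k = filter (\<lambda>a. a \<le> k) w"

text \<open>The parameter \<open>m\<close> is the largest letter, i.e. these are applied to \<open>w \<in> Q1 m\<close>.\<close>

definition Trace :: "nat \<Rightarrow> nat list \<Rightarrow> nat set" where
  "Trace m w = {v. \<exists>k\<in>{2..m}. v \<in> Impap (restrict_word w k)
     \<or> (\<exists>(i, j) \<in> blocks2 (restrict_word w k). v = letter (restrict_word w k) j)}"

definition tr :: "nat \<Rightarrow> nat list \<Rightarrow> nat" where
  "tr m w = card (Trace m w)"

text \<open>
  For \<open>w \<in> Q1 (n + 1)\<close> the subtraction on \<open>nat\<close> never truncates;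
  see \<open>cap_no_truncation\<close> below.
\<close>

definition cap :: "nat \<Rightarrow> nat list \<Rightarrow> nat" where
  "cap n w = n - pap w - impap w - bk2 w"


section \<open>Signed permutations\<close>

text \<open>
  A signed permutation is a bijection of \<open>{-n..n} - {0}\<close>, extended by the identity to a
  function on all integers (as required by \<open>permutes\<close>).
\<close>

definition signed_perms :: "nat \<Rightarrow> (int \<Rightarrow> int) set" where
  "signed_perms n = {\<pi>. \<pi> permutes ({- int n..int n} - {0}) \<and> (\<forall>i. \<pi> (- i) = - \<pi> i)}"

text \<open>
  The map \<open>i \<mapsto> \<bar>\<pi> i\<bar>\<close> permutes \<open>{1..n}\<close>; the orbit of \<open>i\<close> under it is the
  underlying set of the cycle containing \<open>i\<close>.
\<close>

definition cyc :: "nat \<Rightarrow> (int \<Rightarrow> int) \<Rightarrow> nat" where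
  "cyc n \<pi> = card ((\<lambda>i. orbit (\<lambda>j. \<bar>\<pi> j\<bar>) i) ` {1..int n})"

definition exc :: "nat \<Rightarrow> (int \<Rightarrow> int) \<Rightarrow> nat" where
  "exc n \<pi> = card {i \<in> {1..int n}. \<pi> \<bar>\<pi> i\<bar> > \<pi> i}"

definition aexc :: "nat \<Rightarrow> (int \<Rightarrow> int) \<Rightarrow> nat" where
  "aexc n \<pi> = card {i \<in> {1..int n}. \<pi> \<bar>\<pi> i\<bar> < \<pi> i}"

definition fixpts :: "nat \<Rightarrow> (int \<Rightarrow> int) \<Rightarrow> nat" where
  "fixpts n \<pi> = card {i \<in> {1..int n}. \<pi> i = i}"

definition single :: "nat \<Rightarrow> (int \<Rightarrow> int) \<Rightarrow> nat" where
  "single n \<pi> = card {i \<in> {1..int n}. \<pi> i = - i}"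

definition neg :: "nat \<Rightarrow> (int \<Rightarrow> int) \<Rightarrow> nat" where
  "neg n \<pi> = card {i \<in> {1..int n}. \<pi> i < 0}"


section \<open>Well-formedness facts\<close>

lemma finite_Q1: "finite (Q1 m)"
  by (simp add: Q1_def stirling_perms_def)

lemma finite_signed_perms: "finite (signed_perms n)"
proof (rule finite_subset)
  show "signed_perms n \<subseteq> {\<pi>. \<pi> permutes ({- int n..int n} - {0})}"
    by (auto simp: signed_perms_def)
qed (simp add: finite_permutations)

lemma Q1_mset: "w \<in> Q1 m \<Longrightarrow> mset w = {#1#} + (\<Sum>i\<in>{2..m}. {#i, i#})"
  by (simp add: Q1_def stirling_perms_def permutations_of_multiset_def)

lemma Q1_set: "w \<in> Q1 m \<Longrightarrow> set w = insert 1 {2..m}"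
  using Q1_mset[of w m] set_mset_mset[of w] by (simp add: set_mset_sum)

lemma Q1_count:
  assumes "w \<in> Q1 m"
  shows "count_list w v = (if v = 1 then 1 else if v \<in> {2..m} then 2 else 0)"
proof -
  have "count_list w v = count (mset w) v"
    by (simp add: count_mset)
  also have "\<dots> = (if v = 1 then 1 else 0) + (\<Sum>i\<in>{2..m}. count {#i, i#} v)"
    using Q1_mset[OF assms] by (simp add: count_sum)
  also have "(\<Sum>i\<in>{2..m}. count {#i, i#} v) = (\<Sum>i\<in>{2..m}. if v = i then 2 else 0)"
    by (rule sum.cong) auto
  also have "\<dots> = (if v \<in> {2..m} then 2 else 0)"
    by (simp add: sum.delta)
  finally show ?thesis by auto
qed

lemma letter_in_set: "1 \<le> i \<Longrightarrow> i \<le> length w \<Longrightarrow> letter w i \<in> set w"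
  by (simp add: letter_def)

lemma Q1_letter_ge1:
  assumes "w \<in> Q1 m" "1 \<le> i" "i \<le> length w"
  shows "1 \<le> letter w i"
  using letter_in_set[OF assms(2,3)] Q1_set[OF assms(1)] by auto

lemma Q1_stirling:
  assumes "w \<in> Q1 m" "1 \<le> i" "i < j" "j < k" "k \<le> length w" "letter w i = letter w k"
  shows "letter w i \<le> letter w j"
  using assms unfolding Q1_def stirling_perms_def by blast

lemma Q1_repeat:
  assumes w: "w \<in> Q1 m" and L: "2 \<le> length w" and "letter w (length w) \<noteq> 1"
  shows "\<exists>r. 1 \<le> r \<and> r < length w \<and> letter w r = letter w (length w)"
proof -
  let ?u = "letter w (length w)"
  have ne: "w \<noteq> []" using L by auto
  have u: "?u = last w" using ne by (simp add: letter_def last_conv_nth Suc_le_eq)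
  have "?u \<in> set w" by (rule letter_in_set) (use L in auto)
  hence "?u \<in> {2..m}" using Q1_set[OF w] assms(3) by auto
  hence "count_list w ?u = 2" using Q1_count[OF w, of ?u] by simp
  moreover have "count_list w ?u = count_list (butlast w) ?u + 1"
  proof -
    have "count_list (butlast w @ [last w]) ?u = count_list (butlast w) ?u + 1"
      using u by simp
    thus ?thesis using ne by simp
  qed
  ultimately have "count_list (butlast w) ?u \<noteq> 0" by simp
  hence "?u \<in> set (butlast w)" by (metis count_list_0_iff)
  then obtain k where k: "k < length (butlast w)" "butlast w ! k = ?u"
    by (auto simp: in_set_conv_nth)
  moreover from k have "k < length w - 1" by simp
  ultimately have "letter w (Suc k) = ?u"
    by (simp add: letter_def[of w "Suc k"] nth_butlast less_diff_conv)
  thus ?thesis using k(1) by (intro exI[of _ "Suc k"]) auto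
qed

lemma Q1_one_unique:
  assumes w: "w \<in> Q1 m" and "1 \<le> i" "i < j" "j \<le> length w" "letter w i = 1"
  shows "letter w j \<noteq> 1"
proof
  assume "letter w j = 1"
  with assms have a: "w ! (i - 1) = 1" "w ! (j - 1) = 1"
    by (simp_all add: letter_def)
  have "count_list w 1 = card {k. k < length w \<and> w ! k = 1}"
    by (simp add: count_list_eq_length_filter length_filter_conv_card eq_commute)
  moreover have "{i - 1, j - 1} \<subseteq> {k. k < length w \<and> w ! k = 1}"
    using a assms by auto
  hence "card {i - 1, j - 1} \<le> card {k. k < length w \<and> w ! k = 1}"
    by (intro card_mono) auto
  moreover have "card {i - 1, j - 1} = 2" using assms by auto
  ultimately show False using Q1_count[OF w, of 1] by simp
qed

lemma blocks2_D:
  assumes "(i, j) \<in> blocks2 w"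
  shows "j = i + 1" "i \<in> lrmin_positions w" "lrmin_factor w i j"
    "\<And>i' j'. lrmin_factor w i' j' \<Longrightarrow> {i..j} \<subseteq> {i'..j'} \<Longrightarrow> {i..j} = {i'..j'}"
proof -
  have b: "(i, j) \<in> blocks w" and c: "card {i..j} = 2"
    using assms by (auto simp: blocks2_def)
  show f: "lrmin_factor w i j" using b by (simp add: blocks_def)
  show "j = i + 1" using c by simp
  show "i \<in> lrmin_positions w" using f by (auto simp: lrmin_factor_def)
  show "\<And>i' j'. lrmin_factor w i' j' \<Longrightarrow> {i..j} \<subseteq> {i'..j'} \<Longrightarrow> {i..j} = {i'..j'}"
    using b unfolding blocks_def by blast
qed

lemma Q1_blocks2_ge2:
  assumes w: "w \<in> Q1 m" and b: "(i, j) \<in> blocks2 w"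
  shows "2 \<le> letter w i"
proof (rule ccontr)
  note B = blocks2_D[OF b]
  have ij: "1 \<le> i" "i \<le> j" "j \<le> length w" using B(3) by (auto simp: lrmin_factor_def)
  assume "\<not> 2 \<le> letter w i"
  moreover have "1 \<le> letter w i" using Q1_letter_ge1[OF w] ij by auto
  ultimately have one: "letter w i = 1" by simp
  have "{i..length w} \<inter> lrmin_positions w = {i}"
  proof -
    have "k = i" if k: "k \<in> {i..length w}" "k \<in> lrmin_positions w" for k
    proof (rule ccontr)
      assume "k \<noteq> i"
      with k ij have "letter w k < letter w i" by (auto simp: lrmin_positions_def)
      moreover have "1 \<le> letter w k" using Q1_letter_ge1[OF w] k ij by auto
      ultimately show False using one by simp
    qed
    thus ?thesis using B(2) ij by auto
  qed
  hence "lrmin_factor w i (length w)" using ij by (auto simp: lrmin_factor_def)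
  hence "{i..j} = {i..length w}" using ij by (intro B(4)) auto
  hence jL: "j = length w" using ij by (simp add: Icc_eq_Icc)
  have "letter w (length w) \<noteq> 1"
    using Q1_one_unique[OF w, of i j] one ij B(1) jL by auto
  then obtain r where r: "1 \<le> r" "r < length w" "letter w r = letter w (length w)"
    using Q1_repeat[OF w] ij B(1) jL by auto
  have "letter w r \<noteq> 1" using r \<open>letter w (length w) \<noteq> 1\<close> by simp
  hence "r \<noteq> i" using one by auto
  hence "r < i" using r B(1) jL by auto
  hence "letter w r \<le> letter w i"
    using Q1_stirling[OF w, of r i "length w"] r B(1) jL by auto
  moreover have "1 \<le> letter w r" using Q1_letter_ge1[OF w] r by auto
  ultimately show False using one \<open>letter w r \<noteq> 1\<close> by simp
qed

lemma Q1_blocks2_notin_Ap: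
  assumes w: "w \<in> Q1 m" and i: "i \<in> lrmin_positions w"
  shows "letter w i \<notin> Ap w"
proof
  assume "letter w i \<in> Ap w"
  then obtain r where r: "2 \<le> r" "r \<le> length w - 1" "letter w (r - 1) < letter w r"
    "letter w r = letter w i" by (auto simp: Ap_def)
  have i1: "1 \<le> i" using i by (auto simp: lrmin_positions_def)
  have L: "\<And>j. 1 \<le> j \<Longrightarrow> j < i \<Longrightarrow> letter w i < letter w j"
    using i by (auto simp: lrmin_positions_def)
  have "\<not> r < i" using L[of r] r by auto
  moreover have "r \<noteq> i" using L[of "r - 1"] r by force
  moreover have "r - 1 \<noteq> i" using r by auto
  ultimately have "i < r - 1" by auto
  moreover have "r - 1 < r" "r \<le> length w" using r(1,2) by linarith+
  ultimately have "letter w i \<le> letter w (r - 1)"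
    using Q1_stirling[OF w, of i "r - 1" r] r i1 by simp
  thus False using r by simp
qed

lemma cap_no_truncation:
  assumes w: "w \<in> Q1 (n + 1)"
  shows "pap w + impap w + bk2 w \<le> n"
proof -
  have Ap: "Ap w \<subseteq> {2..n + 1}"
  proof
    fix v assume "v \<in> Ap w"
    then obtain r where r: "2 \<le> r" "r \<le> length w - 1" "letter w (r - 1) < letter w r"
      "letter w r = v" by (auto simp: Ap_def)
    have "1 \<le> letter w (r - 1)" using Q1_letter_ge1[OF w, of "r - 1"] r by auto
    moreover have "v \<in> set w" using letter_in_set[of r w] r by auto
    ultimately show "v \<in> {2..n + 1}" using r Q1_set[OF w] by auto
  qed
  have fAp: "finite (Ap w)" using Ap finite_subset by blast
  define V where "V = (\<lambda>(i, j). letter w i) ` blocks2 w"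
  have V: "V \<subseteq> {2..n + 1}"
  proof
    fix v assume "v \<in> V"
    then obtain i j where b: "(i, j) \<in> blocks2 w" "v = letter w i" by (auto simp: V_def)
    have "i \<in> {1..length w}" using blocks2_D(2)[OF b(1)] by (auto simp: lrmin_positions_def)
    hence "v \<in> set w" using letter_in_set[of i w] b by auto
    thus "v \<in> {2..n + 1}" using Q1_set[OF w] Q1_blocks2_ge2[OF w b(1)] b by auto
  qed
  have inj: "inj_on (\<lambda>(i, j). letter w i) (blocks2 w)"
  proof (rule inj_onI, clarify)
    fix i j i' j'
    assume b: "(i, j) \<in> blocks2 w" "(i', j') \<in> blocks2 w" and e: "letter w i = letter w i'"
    note B = blocks2_D(1,2)[OF b(1)] blocks2_D(1,2)[OF b(2)]
    have lt: "letter w b < letter w a"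
      if "a \<in> lrmin_positions w" "b \<in> lrmin_positions w" "a < b" for a b
      using that by (auto simp: lrmin_positions_def)
    have "i = i'"
      using lt[OF B(2) B(4)] lt[OF B(4) B(2)] e by (metis less_irrefl linorder_neqE_nat)
    thus "i = i' \<and> j = j'" using B by simp
  qed
  have "card V = bk2 w" using inj by (simp add: V_def bk2_def card_image)
  moreover have "pap w + impap w = card (Ap w)"
  proof -
    have "Ap w = Pap w \<union> Impap w" "Pap w \<inter> Impap w = {}"
      by (auto simp: Pap_def Impap_def)
    thus ?thesis using fAp unfolding pap_def impap_def
      by (metis card_Un_disjoint finite_Un)
  qed
  moreover have "Ap w \<inter> V = {}"
    using Q1_blocks2_notin_Ap[OF w] blocks2_D(2) by (fastforce simp: V_def)
  moreover have "finite V" using V finite_subset by blast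
  ultimately have "pap w + impap w + bk2 w = card (Ap w \<union> V)"
    using fAp by (simp add: card_Un_disjoint)
  also have "\<dots> \<le> card {2..n + 1}"
    using Ap V by (intro card_mono) auto
  finally show ?thesis by simp
qed

end

theory Submission
  imports Defs
begin

text \<open>
  Both sides satisfy the same recurrence in \<open>n\<close>, for an arbitrary weight \<open>h\<close> in place of the monomial.
  A signed permutation of size \<open>n + 1\<close> arises from one of size \<open>n\<close> by adding
  \<open>\<plusminus>(n + 1)\<close> as a new cycle or by inserting it into one of the \<open>n\<close> arcs of the cycles; the
  insertion destroys that arc (an excedance, anti-excedance, singleton or fixed point) and creates one
  excedance and one anti-excedance. A Stirling permutation in \<open>Q1 (n + 2)\<close> arises from \<open>w\<close> in \<open>Q1 (n + 1)\<close>
  by inserting the pair \<open>m m\<close> with \<open>m = n + 2\<close> into one of the \<open>2 n + 2\<close> gaps of \<open>w\<close>. The first gap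
  creates a block of size 2 and the last one an improper ascent-plateau. Of the \<open>2 n\<close> inner gaps, each
  ascent-plateau \<open>a v v\<close> with \<open>a < v\<close> owns the two gaps around its first \<open>v\<close>, and each block \<open>v v\<close> of
  size 2 owns the two gaps after its letters; using such a gap destroys the owner. The insertion into an inner
  gap always creates a proper ascent-plateau. Since the two gaps of an owner are adjacent, exactly one of
  them is even, which matches the choice of the sign of \<open>n + 1\<close>.
\<close>

section \<open>The insertion operator\<close>

text \<open>
  The summation variable \<open>k\<close> records the sign of the inserted letter, respectively the parity of the gap. Where
  \<open>c - 1\<close> or \<open>d - 1\<close> truncates, the coefficient is 0.
\<close>

definition grow :: "(nat \<Rightarrow> nat \<Rightarrow> nat \<Rightarrow> nat \<Rightarrow> nat \<Rightarrow> nat \<Rightarrow> 'a :: comm_semiring_1)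
    \<Rightarrow> nat \<Rightarrow> nat \<Rightarrow> nat \<Rightarrow> nat \<Rightarrow> nat \<Rightarrow> nat \<Rightarrow> 'a" where
  "grow h a b c d e f = h a b c (d + 1) e (f + 1) + h a b (c + 1) d (e + 1) (f + 1)
     + (\<Sum>k\<in>{e, e + 1}. of_nat a * h a (b + 1) c d k f + of_nat b * h (a + 1) b c d k f
        + of_nat c * h (a + 1) (b + 1) (c - 1) d k f + of_nat d * h (a + 1) (b + 1) c (d - 1) k f)"

section \<open>Signed permutations\<close>

definition signed_letter :: "int set \<Rightarrow> int \<Rightarrow> int" where
  "signed_letter S v = (if v \<in> S then - v else v)"

text \<open>The signs are attached to the letters \<open>\<rho> i\<close>, not to the positions \<open>i\<close>.\<close>

definition with_signs :: "(int \<Rightarrow> int) \<Rightarrow> int set \<Rightarrow> int \<Rightarrow> int" where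
  "with_signs \<rho> S i = (if 0 \<le> i then signed_letter S (\<rho> i) else - signed_letter S (\<rho> (- i)))"

lemma permutes_pos:
  assumes "\<rho> permutes {1..int n}" and "i \<in> {1..int n}"
  shows "\<rho> i \<in> {1..int n}"
  using permutes_in_image[OF assms(1)] assms(2) by blast

lemma with_signs_pos:
  assumes "\<rho> permutes {1..int n}" "i \<in> {1..int n}"
  shows "with_signs \<rho> S i = signed_letter S (\<rho> i)" "\<bar>with_signs \<rho> S i\<bar> = \<rho> i"
  using permutes_pos[OF assms] assms(2) by (auto simp: with_signs_def signed_letter_def)

text \<open>Up to sign the value at \<open>i\<close> is \<open>\<rho> \<bar>i\<bar>\<close>, so two
  arguments with equal values agree up to sign. Opposite arguments are excluded because the map is
  odd and has no zero on the domain.\<close>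

lemma with_signs_in_signed_perms:
  assumes r: "\<rho> permutes {1..int n}" and S: "S \<subseteq> {1..int n}"
  shows "with_signs \<rho> S \<in> signed_perms n"
proof -
  let ?A = "{- int n..int n} - {0}"
  have odd: "with_signs \<rho> S (- i) = - with_signs \<rho> S i" for i
    using S permutes_not_in[OF r, of 0] by (cases i "0::int" rule: linorder_cases) (auto simp: with_signs_def signed_letter_def)
  have out: "with_signs \<rho> S i = i" if "i \<notin> ?A" for i
    using that permutes_not_in[OF r, of i] permutes_not_in[OF r, of "- i"] S
    by (auto simp: with_signs_def signed_letter_def)
  have ab: "\<bar>with_signs \<rho> S i\<bar> = \<rho> \<bar>i\<bar>" if "i \<in> ?A" for i
    using with_signs_pos(2)[OF r, of "\<bar>i\<bar>" S] that odd[of i] by (cases "0 \<le> i") auto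
  have inA: "with_signs \<rho> S i \<in> ?A" if "i \<in> ?A" for i
  proof -
    have "\<rho> \<bar>i\<bar> \<in> {1..int n}" using that by (intro permutes_pos[OF r]) auto
    thus ?thesis using ab[OF that] by auto
  qed
  have "inj_on (with_signs \<rho> S) ?A"
  proof (rule inj_onI)
    fix i j assume ij: "i \<in> ?A" "j \<in> ?A" and e: "with_signs \<rho> S i = with_signs \<rho> S j"
    have "\<rho> \<bar>i\<bar> = \<rho> \<bar>j\<bar>" using ab ij e by metis
    hence "\<bar>i\<bar> = \<bar>j\<bar>" using permutes_inj[OF r] by (auto dest: injD)
    hence "j = i \<or> j = - i" by linarith
    moreover have "j \<noteq> - i" using inA[OF ij(1)] odd[of i] e by auto
    ultimately show "i = j" by simp
  qed
  hence "bij_betw (with_signs \<rho> S) ?A ?A"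
    using inA by (intro bij_betw_imageI endo_inj_surj) auto
  hence "with_signs \<rho> S permutes ?A" using out by (rule bij_imp_permutes)
  thus ?thesis using odd by (simp add: signed_perms_def)
qed

text \<open>Needed to recover \<open>\<rho>\<close> from \<open>\<pi>\<close>: if two absolute
  values agree, then \<open>\<pi> i\<close> equals \<open>\<pi> j\<close> or
  \<open>\<pi> (- j)\<close>, and two positive arguments cannot be opposite.\<close>

lemma signed_perms_abs:
  assumes "\<pi> \<in> signed_perms n"
  shows "(\<lambda>i. if i \<in> {1..int n} then \<bar>\<pi> i\<bar> else i) permutes {1..int n}"
proof (rule bij_imp_permutes)
  let ?r = "\<lambda>i. if i \<in> {1..int n} then \<bar>\<pi> i\<bar> else i"
  have p: "\<pi> permutes ({- int n..int n} - {0})" and o: "\<And>i. \<pi> (- i) = - \<pi> i"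
    using assms by (auto simp: signed_perms_def)
  have im: "?r ` {1..int n} \<subseteq> {1..int n}"
  proof clarsimp
    fix i assume "1 \<le> i" "i \<le> int n"
    hence "\<pi> i \<in> {- int n..int n} - {0}" by (subst permutes_in_image[OF p]) auto
    thus "1 \<le> \<bar>\<pi> i\<bar> \<and> \<bar>\<pi> i\<bar> \<le> int n" by auto
  qed
  have "inj_on ?r {1..int n}"
  proof (rule inj_onI)
    fix i j assume ij: "i \<in> {1..int n}" "j \<in> {1..int n}" and "?r i = ?r j"
    hence "\<pi> i = \<pi> j \<or> \<pi> i = \<pi> (- j)" by (auto simp: o abs_eq_iff)
    hence "i = j \<or> i = - j" using permutes_inj[OF p] by (auto dest: injD)
    thus "i = j" using ij by auto
  qed
  thus "bij_betw ?r {1..int n} {1..int n}"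
    using im by (intro bij_betw_imageI endo_inj_surj) auto
qed auto

lemma bij_with_signs:
  "bij_betw (\<lambda>(\<rho>, S). with_signs \<rho> S) ({\<rho>. \<rho> permutes {1..int n}} \<times> Pow {1..int n}) (signed_perms n)"
proof (rule bij_betw_imageI)
  show "inj_on (\<lambda>(\<rho>, S). with_signs \<rho> S) ({\<rho>. \<rho> permutes {1..int n}} \<times> Pow {1..int n})"
  proof (rule inj_onI, clarify)
    fix \<rho> S \<rho>' S'
    assume r: "\<rho> permutes {1..int n}" "\<rho>' permutes {1..int n}"
      and S: "S \<subseteq> {1..int n}" "S' \<subseteq> {1..int n}" and e: "with_signs \<rho> S = with_signs \<rho>' S'"
    have "\<rho> i = \<rho>' i" for i
      using with_signs_pos(2)[OF r(1), of i S] with_signs_pos(2)[OF r(2), of i S'] e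
        permutes_not_in[OF r(1), of i] permutes_not_in[OF r(2), of i] by metis
    hence rr: "\<rho> = \<rho>'" by auto
    have "v \<in> S \<longleftrightarrow> v \<in> S'" if v: "v \<in> {1..int n}" for v
    proof -
      obtain i where i: "i \<in> {1..int n}" "\<rho> i = v"
        using v permutes_image[OF r(1)] by (metis imageE)
      have "signed_letter S v = signed_letter S' v"
        using with_signs_pos(1)[OF r(1) i(1)] i(2) e rr by metis
      thus ?thesis using v by (auto simp: signed_letter_def split: if_splits)
    qed
    thus "\<rho> = \<rho>' \<and> S = S'" using rr S by blast
  qed
next
  show "(\<lambda>(\<rho>, S). with_signs \<rho> S) ` ({\<rho>. \<rho> permutes {1..int n}} \<times> Pow {1..int n}) = signed_perms n"
  proof (intro subset_antisym subsetI)
    fix \<pi> assume pi: "\<pi> \<in> signed_perms n"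
    define \<rho> where "\<rho> = (\<lambda>i. if i \<in> {1..int n} then \<bar>\<pi> i\<bar> else i)"
    \<comment> \<open>Negative letters are collected by value: \<open>v\<close> is put into
      \<open>S\<close> when \<open>- v\<close> is the image of some positive position.\<close>
    define S where "S = {v \<in> {1..int n}. \<exists>i \<in> {1..int n}. \<pi> i = - v}"
    have p: "\<pi> permutes ({- int n..int n} - {0})" and o: "\<And>i. \<pi> (- i) = - \<pi> i"
      using pi by (auto simp: signed_perms_def)
    have r: "\<rho> permutes {1..int n}" unfolding \<rho>_def by (rule signed_perms_abs[OF pi])
    have pos: "with_signs \<rho> S i = \<pi> i" if i: "i \<in> {1..int n}" for i
    proof -
      have ri: "\<rho> i \<in> {1..int n}" "\<rho> i = \<bar>\<pi> i\<bar>"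
        using permutes_pos[OF r i] i by (auto simp: \<rho>_def)
      have "\<rho> i \<in> S \<longleftrightarrow> \<pi> i < 0"
      proof
        assume "\<rho> i \<in> S"
        then obtain k where k: "k \<in> {1..int n}" "\<pi> k = - \<rho> i" by (auto simp: S_def)
        show "\<pi> i < 0"
        proof (rule ccontr)
          assume "\<not> \<pi> i < 0"
          \<comment> \<open>If \<open>\<pi> i\<close> were positive, it would be the letter
            \<open>\<rho> i\<close> itself, whose negative is the image of \<open>k\<close>; oddness
            then yields the negative argument \<open>- k\<close> with the same value.\<close>
          hence "\<pi> (- k) = \<pi> i" using k ri o[of k] by auto
          hence "- k = i" using permutes_inj[OF p] by (auto dest: injD)
          thus False using k i by auto
        qed
      next
        assume "\<pi> i < 0"
        thus "\<rho> i \<in> S" unfolding S_def using i ri by force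
      qed
      thus ?thesis using with_signs_pos(1)[OF r i] ri by (auto simp: signed_letter_def)
    qed
    have ws: "with_signs \<rho> S \<in> signed_perms n"
      by (rule with_signs_in_signed_perms[OF r]) (auto simp: S_def)
    hence p': "with_signs \<rho> S permutes ({- int n..int n} - {0})"
      and o': "\<And>i. with_signs \<rho> S (- i) = - with_signs \<rho> S i" by (auto simp: signed_perms_def)
    have "with_signs \<rho> S i = \<pi> i" for i
    proof -
      consider "i \<in> {1..int n}" | "- i \<in> {1..int n}" | "i \<notin> {- int n..int n} - {0}" by force
      thus ?thesis
      proof cases
        case 2 thus ?thesis using pos[of "- i"] o[of i] o'[of i] by simp
      qed (use pos permutes_not_in[OF p] permutes_not_in[OF p'] in auto)
    qed
    hence "\<pi> = (\<lambda>(\<rho>, S). with_signs \<rho> S) (\<rho>, S)" by auto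
    moreover have "S \<subseteq> {1..int n}" by (auto simp: S_def)
    ultimately show "\<pi> \<in> (\<lambda>(\<rho>, S). with_signs \<rho> S) ` ({\<rho>. \<rho> permutes {1..int n}} \<times> Pow {1..int n})"
      using r by (intro image_eqI[of _ _ "(\<rho>, S)"]) auto
  qed (use with_signs_in_signed_perms in auto)
qed

section \<open>Statistics of signed permutations read off the arcs\<close>

lemma card_permutes_vimage:
  assumes r: "\<rho> permutes A"
  shows "card {i \<in> A. P (\<rho> i)} = card {v \<in> A. P v}"
proof -
  have "{v \<in> A. P v} = \<rho> ` {i \<in> A. P (\<rho> i)}"
    using permutes_image[OF r] by auto
  thus ?thesis by (metis card_image permutes_inj_on[OF r])
qed

text \<open>The definition at position \<open>i\<close> compares the signed letters of
  \<open>\<rho> i\<close> and \<open>\<rho> (\<rho> i)\<close>. Substituting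
  \<open>v = \<rho> i\<close> turns this into a comparison along the arc from \<open>v\<close> to
  \<open>\<rho> v\<close>, which is the reason for attaching signs to letters.\<close>

lemma exc_with_signs:
  assumes r: "\<rho> permutes {1..int n}"
  shows "exc n (with_signs \<rho> S) = card {v \<in> {1..int n}. signed_letter S v < signed_letter S (\<rho> v)}"
proof -
  have "{i \<in> {1..int n}. with_signs \<rho> S i < with_signs \<rho> S \<bar>with_signs \<rho> S i\<bar>}
      = {i \<in> {1..int n}. signed_letter S (\<rho> i) < signed_letter S (\<rho> (\<rho> i))}"
    using with_signs_pos[OF r] permutes_pos[OF r] by (intro Collect_cong) (auto simp del: atLeastAtMost_iff)
  thus ?thesis unfolding exc_def
    by (simp only: card_permutes_vimage[OF r, where P = "\<lambda>v. signed_letter S v < signed_letter S (\<rho> v)"])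
qed

lemma aexc_with_signs:
  assumes r: "\<rho> permutes {1..int n}"
  shows "aexc n (with_signs \<rho> S) = card {v \<in> {1..int n}. signed_letter S v > signed_letter S (\<rho> v)}"
proof -
  have "{i \<in> {1..int n}. with_signs \<rho> S i > with_signs \<rho> S \<bar>with_signs \<rho> S i\<bar>}
      = {i \<in> {1..int n}. signed_letter S (\<rho> i) > signed_letter S (\<rho> (\<rho> i))}"
    using with_signs_pos[OF r] permutes_pos[OF r] by (intro Collect_cong) (auto simp del: atLeastAtMost_iff)
  thus ?thesis unfolding aexc_def
    by (simp only: card_permutes_vimage[OF r, where P = "\<lambda>v. signed_letter S v > signed_letter S (\<rho> v)"])
qed

lemma fixpts_with_signs:
  assumes r: "\<rho> permutes {1..int n}"
  shows "fixpts n (with_signs \<rho> S) = card {v \<in> {1..int n}. \<rho> v = v \<and> v \<notin> S}"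
  unfolding fixpts_def
proof (intro arg_cong[of _ _ card] Collect_cong conj_cong refl)
  fix i assume i: "i \<in> {1..int n}"
  have "i > 0" "\<rho> i > 0" using permutes_pos[OF r i] i by simp_all
  thus "with_signs \<rho> S i = i \<longleftrightarrow> \<rho> i = i \<and> i \<notin> S"
    by (auto simp: with_signs_pos(1)[OF r i] signed_letter_def)
qed

lemma single_with_signs:
  assumes r: "\<rho> permutes {1..int n}"
  shows "single n (with_signs \<rho> S) = card {v \<in> {1..int n}. \<rho> v = v \<and> v \<in> S}"
  unfolding single_def
proof (intro arg_cong[of _ _ card] Collect_cong conj_cong refl)
  fix i assume i: "i \<in> {1..int n}"
  have "i > 0" "\<rho> i > 0" using permutes_pos[OF r i] i by simp_all
  thus "with_signs \<rho> S i = - i \<longleftrightarrow> \<rho> i = i \<and> i \<in> S"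
    by (auto simp: with_signs_pos(1)[OF r i] signed_letter_def)
qed

lemma neg_with_signs:
  assumes r: "\<rho> permutes {1..int n}" and S: "S \<subseteq> {1..int n}"
  shows "neg n (with_signs \<rho> S) = card S"
proof -
  have "{i \<in> {1..int n}. with_signs \<rho> S i < 0} = {i \<in> {1..int n}. \<rho> i \<in> S}"
  proof (intro Collect_cong conj_cong refl)
    fix i assume i: "i \<in> {1..int n}"
    have "\<rho> i > 0" using permutes_pos[OF r i] by simp
    thus "with_signs \<rho> S i < 0 \<longleftrightarrow> \<rho> i \<in> S"
      by (simp add: with_signs_pos(1)[OF r i] signed_letter_def)
  qed
  hence "neg n (with_signs \<rho> S) = card {v \<in> {1..int n}. v \<in> S}"
    unfolding neg_def by (simp only: card_permutes_vimage[OF r, where P = "\<lambda>v. v \<in> S"])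
  also have "{v \<in> {1..int n}. v \<in> S} = S" using S by auto
  finally show ?thesis .
qed

lemma cyc_with_signs:
  assumes r: "\<rho> permutes {1..int n}"
  shows "cyc n (with_signs \<rho> S) = card (orbit \<rho> ` {1..int n})"
proof -
  have "orbit (\<lambda>j. \<bar>with_signs \<rho> S j\<bar>) i = orbit \<rho> i" if "i \<in> {1..int n}" for i
    using that with_signs_pos(2)[OF r] permutes_pos[OF r]
    by (intro orbit_cong0[of _ "{1..int n}"]) (auto simp del: atLeastAtMost_iff)
  hence "orbit (\<lambda>j. \<bar>with_signs \<rho> S j\<bar>) ` {1..int n} = orbit \<rho> ` {1..int n}"
    by (intro image_cong) auto
  thus ?thesis by (simp only: cyc_def)
qed

section \<open>Inserting a point into a cycle\<close>

text \<open>The composed map sends \<open>u\<close> to \<open>N\<close> and \<open>N\<close> to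
  \<open>\<rho> u\<close>, so a walk along it is a walk along \<open>\<rho>\<close> with a detour
  through \<open>N\<close> whenever it leaves \<open>u\<close>.\<close>

lemma orbit_insert_point:
  assumes r: "\<rho> permutes A" and N: "N \<notin> A" and u: "u \<in> A" and i: "i \<in> A"
  shows "orbit (\<rho> \<circ> transpose N u) i \<inter> A = orbit \<rho> i"
proof -
  define g where "g = \<rho> \<circ> transpose N u"
  have g: "g u = N" "g N = \<rho> u" "\<And>v. v \<in> A \<Longrightarrow> v \<noteq> u \<Longrightarrow> g v = \<rho> v"
    using permutes_not_in[OF r N] N by (auto simp: g_def transpose_def)
  have rA: "\<rho> v \<in> A" if "v \<in> A" for v using permutes_in_image[OF r] that by blast
  have gA: "(g v \<in> A \<and> g v = \<rho> v) \<or> (g v = N \<and> v = u)" if "v \<in> A" for v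
    using g that rA by metis
  \<comment> \<open>The second alternative records where the detour returns to, which the induction
    needs for the step leaving \<open>N\<close>.\<close>
  have 1: "y \<in> A \<and> y \<in> orbit \<rho> i \<or> y = N \<and> \<rho> u \<in> orbit \<rho> i" if "y \<in> orbit g i" for y
    using that
  proof induction
    case base
    show ?case using gA[OF i] orbit.base[of \<rho> i] by auto
  next
    case (step y)
    show ?case using step(2)
    proof
      assume y: "y \<in> A \<and> y \<in> orbit \<rho> i"
      hence "\<rho> y \<in> orbit \<rho> i" by (auto intro: orbit.step)
      thus ?thesis using gA[of y] y by auto
    next
      assume "y = N \<and> \<rho> u \<in> orbit \<rho> i"
      thus ?thesis using g(2) rA[OF u] by auto
    qed
  qed
  \<comment> \<open>For \<open>v = u\<close> two steps of \<open>g\<close> are needed, the first of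
    them to \<open>N\<close>.\<close>
  have lift: "\<rho> v \<in> orbit g i" if "v \<in> A" "g v \<in> orbit g i" for v
    using gA[OF that(1)] that(2) g(2) orbit.step[of "g v" g i] by auto
  have 2: "y \<in> A \<and> y \<in> orbit g i" if "y \<in> orbit \<rho> i" for y
    using that
  proof induction
    case base
    show ?case using rA[OF i] lift[OF i orbit.base] by simp
  next
    case (step y)
    thus ?case using rA[of y] lift[of y] orbit.step[of y g i] by simp
  qed
  show ?thesis using 1 2 N unfolding g_def by blast
qed

lemma orbit_eq_of_mem:
  assumes "permutation f" "y \<in> orbit f x"
  shows "orbit f y = orbit f x"
  using orbit_swap[OF permutation_self_in_orbit[OF assms(1)] assms(2)] assms(2)
  by (blast intro: orbit_trans)

text \<open>\<open>N\<close> shares the orbit of \<open>u\<close>, so it adds no orbit, and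
  intersecting with \<open>A\<close> matches the new orbits with the old ones. That map is injective
  since orbits of a permutation with a common point coincide.\<close>

lemma card_orbits_insert_point:
  assumes fin: "finite A" and r: "\<rho> permutes A" and N: "N \<notin> A" and u: "u \<in> A"
  shows "card (orbit (\<rho> \<circ> transpose N u) ` insert N A) = card (orbit \<rho> ` A)"
proof -
  let ?r = "\<rho> \<circ> transpose N u"
  have r': "?r permutes insert N A"
    using r u by (intro permutes_compose permutes_swap_id permutes_subset[OF r]) auto
  have p: "permutation ?r" using r' fin by (auto simp: permutation_permutes)
  have "?r u = N" using permutes_not_in[OF r N] by simp
  hence "N \<in> orbit ?r u" using orbit.base[of ?r u] by simp
  hence "orbit ?r N = orbit ?r u"
    by (rule orbit_eq_of_mem[OF p])
  hence "orbit ?r ` insert N A = orbit ?r ` A" using u by auto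
  moreover have "inj_on (\<lambda>B. B \<inter> A) (orbit ?r ` A)"
  proof (rule inj_onI, clarify)
    fix i j assume ij: "i \<in> A" "j \<in> A" and e: "orbit ?r i \<inter> A = orbit ?r j \<inter> A"
    have "i \<in> orbit ?r i" using permutation_self_in_orbit[OF p] .
    hence "i \<in> orbit ?r j" using e ij by auto
    thus "orbit ?r i = orbit ?r j" by (rule orbit_eq_of_mem[OF p])
  qed
  moreover have "(\<lambda>B. B \<inter> A) ` orbit ?r ` A = orbit \<rho> ` A"
    unfolding image_image by (intro image_cong orbit_insert_point[OF r N u]) auto
  ultimately show ?thesis by (metis card_image)
qed

text \<open>The library decomposition composes with \<open>transpose N b\<close> on the left, where
  \<open>b\<close> is the image of \<open>N\<close>. Reindexing by \<open>b = \<rho> u\<close> moves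
  it to the right, where \<open>u\<close> names the arc that receives \<open>N\<close>; the choice
  \<open>b = N\<close> leaves \<open>N\<close> fixed.\<close>

lemma sum_permutes_insert:
  assumes fin: "finite A" and N: "N \<notin> A"
  shows "(\<Sum>\<rho> | \<rho> permutes insert N A. f \<rho>)
    = (\<Sum>\<rho> | \<rho> permutes A. f \<rho> + (\<Sum>u\<in>A. f (\<rho> \<circ> transpose N u)))"
proof -
  have "(\<Sum>\<rho> | \<rho> permutes insert N A. f \<rho>)
    = (\<Sum>b\<in>insert N A. \<Sum>\<rho> | \<rho> permutes A. f (transpose N b \<circ> \<rho>))"
    by (rule sum_over_permutations_insert[OF fin N])
  also have "\<dots> = (\<Sum>\<rho> | \<rho> permutes A. \<Sum>b\<in>insert N A. f (transpose N b \<circ> \<rho>))"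
    by (rule sum.swap)
  also have "\<dots> = (\<Sum>\<rho> | \<rho> permutes A. f \<rho> + (\<Sum>u\<in>A. f (\<rho> \<circ> transpose N u)))"
  proof (rule sum.cong[OF refl])
    fix \<rho> assume "\<rho> \<in> {\<rho>. \<rho> permutes A}"
    hence r: "\<rho> permutes A" by simp
    have "transpose N (\<rho> u) \<circ> \<rho> = \<rho> \<circ> transpose N u" for u
    proof (rule ext)
      fix v
      have "\<rho> v = N \<longleftrightarrow> v = N" "\<rho> v = \<rho> u \<longleftrightarrow> v = u"
        using permutes_not_in[OF r N] permutes_inj[OF r] by (metis injD)+
      thus "(transpose N (\<rho> u) \<circ> \<rho>) v = (\<rho> \<circ> transpose N u) v"
        using permutes_not_in[OF r N] by (simp add: transpose_def)
    qed
    hence "(\<Sum>b\<in>A. f (transpose N b \<circ> \<rho>)) = (\<Sum>u\<in>A. f (\<rho> \<circ> transpose N u))"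
      using sum.reindex_bij_betw[OF permutes_imp_bij[OF r], of "\<lambda>b. f (transpose N b \<circ> \<rho>)"]
      by simp
    thus "(\<Sum>b\<in>insert N A. f (transpose N b \<circ> \<rho>)) = f \<rho> + (\<Sum>u\<in>A. f (\<rho> \<circ> transpose N u))"
      using fin N by simp
  qed
  finally show ?thesis .
qed

lemma sum_Pow_insert:
  assumes "finite A" "N \<notin> A"
  shows "(\<Sum>S\<in>Pow (insert N A). f S) = (\<Sum>S\<in>Pow A. f S + f (insert N S))"
proof -
  have "(\<Sum>S\<in>Pow (insert N A). f S) = (\<Sum>S\<in>Pow A. f S) + (\<Sum>S\<in>insert N ` Pow A. f S)"
    unfolding Pow_insert using assms by (intro sum.union_disjoint) auto
  also have "(\<Sum>S\<in>insert N ` Pow A. f S) = (\<Sum>S\<in>Pow A. f (insert N S))"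
    using assms(2) by (subst sum.reindex) (auto intro!: inj_onI)
  finally show ?thesis by (simp add: sum.distrib)
qed

section \<open>Recurrence for signed permutations\<close>

text \<open>For \<open>A = {1..int n}\<close> and \<open>S\<close> inside it, this is the weight of
  \<open>with_signs \<rho> S\<close>. The ground set is a parameter so that the same expression
  covers the set enlarged by a new letter.\<close>

definition arc_sum where
  "arc_sum h \<rho> S A = h (card {v \<in> A. signed_letter S v < signed_letter S (\<rho> v)})
     (card {v \<in> A. signed_letter S v > signed_letter S (\<rho> v)})
     (card {v \<in> A. \<rho> v = v \<and> v \<in> S}) (card {v \<in> A. \<rho> v = v \<and> v \<notin> S})
     (card S) (card (orbit \<rho> ` A))"

lemma sum_signed_perms_eq:
  "(\<Sum>\<pi>\<in>signed_perms n. h (exc n \<pi>) (aexc n \<pi>) (single n \<pi>) (fixpts n \<pi>) (neg n \<pi>) (cyc n \<pi>))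
   = (\<Sum>\<rho> | \<rho> permutes {1..int n}. \<Sum>S\<in>Pow {1..int n}. arc_sum h \<rho> S {1..int n})"
proof -
  let ?h = "\<lambda>\<pi>. h (exc n \<pi>) (aexc n \<pi>) (single n \<pi>) (fixpts n \<pi>) (neg n \<pi>) (cyc n \<pi>)"
  let ?P = "{\<rho>. \<rho> permutes {1..int n}}"
  have "?h (with_signs \<rho> S) = arc_sum h \<rho> S {1..int n}" if r: "\<rho> \<in> ?P" and S: "S \<in> Pow {1..int n}" for \<rho> S
  proof -
    have r': "\<rho> permutes {1..int n}" and S': "S \<subseteq> {1..int n}" using r S by auto
    show ?thesis
      unfolding arc_sum_def exc_with_signs[OF r'] aexc_with_signs[OF r'] single_with_signs[OF r']
        fixpts_with_signs[OF r'] neg_with_signs[OF r' S'] cyc_with_signs[OF r'] by (rule refl)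
  qed
  hence "(\<Sum>(\<rho>, S)\<in>?P \<times> Pow {1..int n}. ?h (with_signs \<rho> S))
      = (\<Sum>(\<rho>, S)\<in>?P \<times> Pow {1..int n}. arc_sum h \<rho> S {1..int n})"
    by (intro sum.cong refl) auto
  thus ?thesis
    using sum.reindex_bij_betw[OF bij_with_signs, of ?h]
    by (simp add: sum.cartesian_product case_prod_unfold)
qed

lemma card_Diff_disjoint_singleton:
  assumes "u \<in> X" "X \<inter> Y = {}"
  shows "card (Y - {u}) = card Y"
proof -
  have "Y - {u} = Y" using assms by auto
  thus ?thesis by simp
qed

text \<open>The algebra shared by both sides, where \<open>u\<close> is an arc or a gap. Destroying
  \<open>u\<close> lowers its own class by one while \<open>E\<close> and \<open>A\<close> always
  gain one, so for \<open>u\<close> in \<open>E\<close> or \<open>A\<close> the two changes of that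
  class cancel. The summand is constant on each class.\<close>

lemma sum_remove_from_class:
  fixes h :: "nat \<Rightarrow> nat \<Rightarrow> nat \<Rightarrow> nat \<Rightarrow> 'a :: comm_semiring_1"
  assumes fin: "finite E" "finite A" "finite C" "finite D"
    and dis: "E \<inter> A = {}" "E \<inter> C = {}" "E \<inter> D = {}" "A \<inter> C = {}" "A \<inter> D = {}" "C \<inter> D = {}"
  shows "(\<Sum>u\<in>E \<union> A \<union> C \<union> D. h (card (E - {u}) + 1) (card (A - {u}) + 1) (card (C - {u})) (card (D - {u})))
    = of_nat (card E) * h (card E) (card A + 1) (card C) (card D)
      + of_nat (card A) * h (card E + 1) (card A) (card C) (card D)
      + of_nat (card C) * h (card E + 1) (card A + 1) (card C - 1) (card D)
      + of_nat (card D) * h (card E + 1) (card A + 1) (card C) (card D - 1)"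
proof -
  let ?g = "\<lambda>u. h (card (E - {u}) + 1) (card (A - {u}) + 1) (card (C - {u})) (card (D - {u}))"
  note rm = card_Diff_disjoint_singleton
  have "?g u = h (card E) (card A + 1) (card C) (card D)" if "u \<in> E" for u
    using that rm[OF that] dis fin card_Suc_Diff1[OF fin(1) that] by (simp add: Int_commute)
  moreover have "?g u = h (card E + 1) (card A) (card C) (card D)" if "u \<in> A" for u
    using that rm[OF that] dis fin card_Suc_Diff1[OF fin(2) that] by (simp add: Int_commute)
  moreover have "?g u = h (card E + 1) (card A + 1) (card C - 1) (card D)" if "u \<in> C" for u
    using that rm[OF that] dis fin by (simp add: Int_commute)
  moreover have "?g u = h (card E + 1) (card A + 1) (card C) (card D - 1)" if "u \<in> D" for u
    using that rm[OF that] dis fin by (simp add: Int_commute)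
  moreover have "(\<Sum>u\<in>E \<union> A \<union> C \<union> D. ?g u) = sum ?g E + sum ?g A + sum ?g C + sum ?g D"
    using fin dis by (simp add: sum.union_disjoint Int_Un_distrib2)
  ultimately show ?thesis by (simp del: One_nat_def)
qed

text \<open>\<open>N\<close> is a fixed point of \<open>\<rho>\<close>, so it forms a cycle of its
  own and its arc is neither an excedance nor an anti-excedance. Its sign decides between
  \<open>fixpts\<close> and \<open>single\<close>.\<close>

lemma arc_sum_new_fixpoint:
  assumes r: "\<rho> permutes {1..int n}" and S: "S \<subseteq> {1..int n}"
  defines "N \<equiv> int n + 1"
  shows "arc_sum h \<rho> S (insert N {1..int n}) = arc_sum (\<lambda>a b c d e f. h a b c (d + 1) e (f + 1)) \<rho> S {1..int n}" (is ?pos)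
    and "arc_sum h \<rho> (insert N S) (insert N {1..int n})
      = arc_sum (\<lambda>a b c d e f. h a b (c + 1) d (e + 1) (f + 1)) \<rho> S {1..int n}" (is ?neg)
proof -
  let ?A = "{1..int n}"
  have N: "N \<notin> ?A" "N \<notin> S" "finite S" using S finite_subset[OF S] by (auto simp: N_def)
  have rN: "\<rho> N = N" using permutes_not_in[OF r N(1)] .
  have rA: "\<rho> v \<in> ?A" if "v \<in> ?A" for v using permutes_pos[OF r that] .
  \<comment> \<open>Orbits of points of \<open>?A\<close> stay inside \<open>?A\<close>, whereas
    \<open>N\<close> belongs to its own orbit.\<close>
  have "orbit \<rho> N \<notin> orbit \<rho> ` ?A"
  proof
    assume "orbit \<rho> N \<in> orbit \<rho> ` ?A"
    then obtain i where "i \<in> ?A" "N \<in> orbit \<rho> i" using orbit.base[of \<rho> N] rN by auto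
    thus False using permutes_orbit_subset[OF r] N(1) by blast
  qed
  hence orb: "card (orbit \<rho> ` insert N ?A) = card (orbit \<rho> ` ?A) + 1" by simp
  have ins: "{v \<in> insert N ?A. P v} = (if P N then insert N {v \<in> ?A. P v} else {v \<in> ?A. P v})" for P
    by auto
  have letter_eq: "signed_letter (insert N S) v = signed_letter S v" if "v \<in> ?A" for v
    using that N(1) by (auto simp: signed_letter_def)
  have E: "{v \<in> ?A. signed_letter (insert N S) v < signed_letter (insert N S) (\<rho> v)}
      = {v \<in> ?A. signed_letter S v < signed_letter S (\<rho> v)}"
    using letter_eq rA by (intro Collect_cong) (metis (no_types))
  have A: "{v \<in> ?A. signed_letter (insert N S) v > signed_letter (insert N S) (\<rho> v)}
      = {v \<in> ?A. signed_letter S v > signed_letter S (\<rho> v)}"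
    using letter_eq rA by (intro Collect_cong) (metis (no_types))
  have C: "{v \<in> ?A. \<rho> v = v \<and> v \<in> insert N S} = {v \<in> ?A. \<rho> v = v \<and> v \<in> S}"
    and D: "{v \<in> ?A. \<rho> v = v \<and> v \<notin> insert N S} = {v \<in> ?A. \<rho> v = v \<and> v \<notin> S}"
    using N(1) by auto
  have fin: "finite {v \<in> ?A. P v}" "N \<notin> {v \<in> ?A. P v}" for P
    using N(1) by (simp_all del: atLeastAtMost_iff)
  show ?pos unfolding arc_sum_def ins orb using rN N fin by (simp add: fin)
  show ?neg unfolding arc_sum_def ins orb E A C D using rN N fin by (simp add: fin)
qed

text \<open>Only the arc leaving \<open>u\<close> is lost; the arcs from \<open>u\<close> to
  \<open>N\<close> and from \<open>N\<close> to \<open>\<rho> u\<close> replace it. As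
  \<open>N\<close> exceeds all other letters in absolute value, one of these rises and the other
  falls, whichever sign \<open>N\<close> has.\<close>

lemma arc_sum_insert_point:
  assumes r: "\<rho> permutes {1..int n}" and S: "S \<subseteq> {1..int n}" and u: "u \<in> {1..int n}"
  defines "N \<equiv> int n + 1"
  assumes T: "T = S \<or> T = insert N S"
  shows "arc_sum h (\<rho> \<circ> transpose N u) T (insert N {1..int n})
    = h (card ({v \<in> {1..int n}. signed_letter S v < signed_letter S (\<rho> v)} - {u}) + 1)
        (card ({v \<in> {1..int n}. signed_letter S v > signed_letter S (\<rho> v)} - {u}) + 1)
        (card ({v \<in> {1..int n}. \<rho> v = v \<and> v \<in> S} - {u}))
        (card ({v \<in> {1..int n}. \<rho> v = v \<and> v \<notin> S} - {u}))
        (card T) (card (orbit \<rho> ` {1..int n}))"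
proof -
  let ?A = "{1..int n}"
  define g where "g = \<rho> \<circ> transpose N u"
  have N: "N \<notin> ?A" "N \<notin> S" using S by (auto simp: N_def)
  have g: "g u = N" "g N = \<rho> u" "\<And>v. v \<in> ?A - {u} \<Longrightarrow> g v = \<rho> v"
    using permutes_not_in[OF r N(1)] N by (auto simp: g_def transpose_def)
  have rA: "\<rho> v \<in> ?A" if "v \<in> ?A" for v using permutes_pos[OF r that] .
  have letter_eq: "signed_letter T v = signed_letter S v" "\<bar>signed_letter T v\<bar> < N" if "v \<in> ?A" for v
    using that N(1) T by (auto simp: signed_letter_def N_def)
  have letN: "signed_letter T N = (if T = S then N else - N)"
    using T N by (auto simp: signed_letter_def)
  have orb: "card (orbit g ` insert N ?A) = card (orbit \<rho> ` ?A)"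
    unfolding g_def by (rule card_orbits_insert_point[OF _ r N(1) u]) simp
  have split: "{v \<in> insert N ?A. P v} = {v. v = N \<and> P N} \<union> {v. v = u \<and> P u} \<union> {v \<in> ?A - {u}. P v}" for P
    using u by auto
  have fin: "finite ({v \<in> ?A. P v} - {u})" "N \<notin> {v \<in> ?A. P v} - {u}" "u \<notin> {v \<in> ?A. P v} - {u}" for P
    using N(1) by (simp_all del: atLeastAtMost_iff)
  have Nu: "N \<noteq> u" using N(1) u by auto
  have old: "{v \<in> ?A - {u}. P (signed_letter T v) (signed_letter T (g v))} = {v \<in> ?A. P (signed_letter S v) (signed_letter S (\<rho> v))} - {u}" for P
    using g(3) letter_eq(1) rA by fastforce
  \<comment> \<open>\<open>T = S\<close> means that \<open>N\<close> is positive, and then the arc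
    leaving \<open>u\<close> is the rising one; for negative \<open>N\<close> it is the arc leaving
    \<open>N\<close>.\<close>
  have E: "{v \<in> insert N ?A. signed_letter T v < signed_letter T (g v)}
      = insert (if T = S then u else N) ({v \<in> ?A. signed_letter S v < signed_letter S (\<rho> v)} - {u})"
    unfolding split old[of "(<)"] using letter_eq(2)[OF u] letter_eq(2)[OF rA[OF u]] letN g by auto
  have A: "{v \<in> insert N ?A. signed_letter T v > signed_letter T (g v)}
      = insert (if T = S then N else u) ({v \<in> ?A. signed_letter S v > signed_letter S (\<rho> v)} - {u})"
    unfolding split old[of "(>)"] using letter_eq(2)[OF u] letter_eq(2)[OF rA[OF u]] letN g by auto
  have not: "g N \<noteq> N" "g u \<noteq> u" using g N(1) rA[OF u] Nu by metis+
  have C: "{v \<in> insert N ?A. g v = v \<and> v \<in> T} = {v \<in> ?A. \<rho> v = v \<and> v \<in> S} - {u}"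
    and D: "{v \<in> insert N ?A. g v = v \<and> v \<notin> T} = {v \<in> ?A. \<rho> v = v \<and> v \<notin> S} - {u}"
    unfolding split using g(3) not T N(1) by auto
  have "card (insert w ({v \<in> ?A. P v} - {u})) = card ({v \<in> ?A. P v} - {u}) + 1" if "w = u \<or> w = N" for w P
    using that fin by (subst card_insert_disjoint) (auto simp del: atLeastAtMost_iff)
  hence "card (insert (if T = S then u else N) ({v \<in> ?A. P v} - {u})) = card ({v \<in> ?A. P v} - {u}) + 1"
    "card (insert (if T = S then N else u) ({v \<in> ?A. P v} - {u})) = card ({v \<in> ?A. P v} - {u}) + 1" for P
    by presburger+
  note card_ins = this
  show ?thesis unfolding arc_sum_def g_def[symmetric] E A C D orb card_ins by (rule refl)
qed

lemma sum_signed_perms_Suc: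
  fixes h :: "nat \<Rightarrow> nat \<Rightarrow> nat \<Rightarrow> nat \<Rightarrow> nat \<Rightarrow> nat \<Rightarrow> 'a :: comm_semiring_1"
  shows "(\<Sum>\<pi>\<in>signed_perms (Suc n). h (exc (Suc n) \<pi>) (aexc (Suc n) \<pi>) (single (Suc n) \<pi>)
      (fixpts (Suc n) \<pi>) (neg (Suc n) \<pi>) (cyc (Suc n) \<pi>))
   = (\<Sum>\<pi>\<in>signed_perms n. grow h (exc n \<pi>) (aexc n \<pi>) (single n \<pi>) (fixpts n \<pi>) (neg n \<pi>) (cyc n \<pi>))"
proof -
  let ?A = "{1..int n}" and ?N = "int n + 1"
  have ins: "{1..int (Suc n)} = insert ?N ?A" by auto
  have N: "?N \<notin> ?A" by simp
  have "arc_sum h \<rho> S (insert ?N ?A) + arc_sum h \<rho> (insert ?N S) (insert ?N ?A)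
      + (\<Sum>u\<in>?A. arc_sum h (\<rho> \<circ> transpose ?N u) S (insert ?N ?A)
           + arc_sum h (\<rho> \<circ> transpose ?N u) (insert ?N S) (insert ?N ?A))
      = arc_sum (grow h) \<rho> S ?A" if r: "\<rho> permutes ?A" and S: "S \<subseteq> ?A" for \<rho> S
  proof -
    let ?E = "{v \<in> ?A. signed_letter S v < signed_letter S (\<rho> v)}"
    let ?X = "{v \<in> ?A. signed_letter S v > signed_letter S (\<rho> v)}"
    let ?C = "{v \<in> ?A. \<rho> v = v \<and> v \<in> S}" and ?D = "{v \<in> ?A. \<rho> v = v \<and> v \<notin> S}"
    \<comment> \<open>The arcs that neither rise nor fall are exactly the fixed points, so the four
      classes exhaust \<open>?A\<close>.\<close>
    have eq: "signed_letter S v = signed_letter S (\<rho> v) \<longleftrightarrow> \<rho> v = v" if "v \<in> ?A" for v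
      using that permutes_pos[OF r that] by (auto simp: signed_letter_def)
    have U: "?A = ?E \<union> ?X \<union> ?C \<union> ?D"
    proof (intro subset_antisym subsetI)
      fix v assume v: "v \<in> ?A"
      show "v \<in> ?E \<union> ?X \<union> ?C \<union> ?D"
        using eq[OF v] v less_linear[of "signed_letter S v" "signed_letter S (\<rho> v)"]
        by (auto simp del: atLeastAtMost_iff)
    qed auto
    have cS: "card (insert ?N S) = card S + 1"
      using S finite_subset[OF S] by (subst card_insert_disjoint) auto
    have ins_sum: "(\<Sum>u\<in>?A. arc_sum h (\<rho> \<circ> transpose ?N u) T (insert ?N ?A))
      = of_nat (card ?E) * h (card ?E) (card ?X + 1) (card ?C) (card ?D) (card T) (card (orbit \<rho> ` ?A))
      + of_nat (card ?X) * h (card ?E + 1) (card ?X) (card ?C) (card ?D) (card T) (card (orbit \<rho> ` ?A))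
      + of_nat (card ?C) * h (card ?E + 1) (card ?X + 1) (card ?C - 1) (card ?D) (card T) (card (orbit \<rho> ` ?A))
      + of_nat (card ?D) * h (card ?E + 1) (card ?X + 1) (card ?C) (card ?D - 1) (card T) (card (orbit \<rho> ` ?A))"
      if T: "T = S \<or> T = insert ?N S" for T
    proof -
      have "(\<Sum>u\<in>?A. arc_sum h (\<rho> \<circ> transpose ?N u) T (insert ?N ?A))
        = (\<Sum>u\<in>?E \<union> ?X \<union> ?C \<union> ?D. h (card (?E - {u}) + 1) (card (?X - {u}) + 1) (card (?C - {u}))
             (card (?D - {u})) (card T) (card (orbit \<rho> ` ?A)))"
        using arc_sum_insert_point[OF r S _ T, of _ h] by (intro sum.cong U) auto
      also have "\<dots> = of_nat (card ?E) * h (card ?E) (card ?X + 1) (card ?C) (card ?D) (card T) (card (orbit \<rho> ` ?A))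
      + of_nat (card ?X) * h (card ?E + 1) (card ?X) (card ?C) (card ?D) (card T) (card (orbit \<rho> ` ?A))
      + of_nat (card ?C) * h (card ?E + 1) (card ?X + 1) (card ?C - 1) (card ?D) (card T) (card (orbit \<rho> ` ?A))
      + of_nat (card ?D) * h (card ?E + 1) (card ?X + 1) (card ?C) (card ?D - 1) (card T) (card (orbit \<rho> ` ?A))"
        by (rule sum_remove_from_class) (auto simp del: atLeastAtMost_iff)
      finally show ?thesis .
    qed
    \<comment> \<open>The choices \<open>T = S\<close> and \<open>T = insert ?N S\<close> give the
      summands \<open>k = e\<close> and \<open>k = e + 1\<close> of \<open>grow\<close>.\<close>
    show ?thesis
      unfolding sum.distrib arc_sum_new_fixpoint[OF r S] ins_sum[OF disjI1[OF refl]]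
        ins_sum[OF disjI2[OF refl]] cS
      by (simp add: arc_sum_def grow_def add_ac)
  qed
  note step = this
  have "(\<Sum>\<rho> | \<rho> permutes insert ?N ?A. \<Sum>S\<in>Pow (insert ?N ?A). arc_sum h \<rho> S (insert ?N ?A))
    = (\<Sum>\<rho> | \<rho> permutes ?A. \<Sum>S\<in>Pow ?A. arc_sum (grow h) \<rho> S ?A)"
    unfolding sum_permutes_insert[OF finite_atLeastAtMost_int N] sum_Pow_insert[OF finite_atLeastAtMost_int N]
    by (subst sum.swap, subst sum.distrib[symmetric], intro sum.cong refl) (simp add: step)
  thus ?thesis unfolding sum_signed_perms_eq ins .
qed

section \<open>Stirling permutations\<close>

definition insert_pair :: "nat \<Rightarrow> nat \<Rightarrow> nat list \<Rightarrow> nat list" where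
  "insert_pair m j w = take j w @ [m, m] @ drop j w"

text \<open>The new position of the old letter at \<open>i\<close> once a pair has been placed in
  gap \<open>j\<close>. Positions are counted from 0, and gap \<open>j\<close> lies just before
  letter \<open>j\<close>.\<close>

definition skip_pair :: "nat \<Rightarrow> nat \<Rightarrow> nat" where
  "skip_pair j i = (if i < j then i else i + 2)"

lemma length_insert_pair: "length (insert_pair m j w) = length w + 2"
  by (simp add: insert_pair_def)

lemma nth_insert_pair:
  assumes "j \<le> length w"
  shows "insert_pair m j w ! i = (if i < j then w ! i else if i < j + 2 then m else w ! (i - 2))"
proof -
  have "i = j \<or> i = j + 1" if "\<not> i < j" "i < j + 2" using that by linarith
  moreover have "j + (i - Suc (Suc j)) = i - 2" if "\<not> i < j + 2" using that by linarith
  ultimately show ?thesis using assms by (auto simp: insert_pair_def nth_append nth_Cons')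
qed

lemma nth_insert_pair_skip:
  "j \<le> length w \<Longrightarrow> insert_pair m j w ! skip_pair j i = w ! i"
  by (simp add: nth_insert_pair skip_pair_def)

lemma skip_pair_less: "j \<le> length w \<Longrightarrow> skip_pair j i < length w + 2 \<longleftrightarrow> i < length w"
  by (auto simp: skip_pair_def)

lemma skip_pair_mono: "skip_pair j i < skip_pair j k \<longleftrightarrow> i < k"
  by (auto simp: skip_pair_def)

lemma inj_skip_pair: "inj (skip_pair j)"
  by (rule injI) (auto simp: skip_pair_def split: if_splits)

lemma skip_pair_cases:
  assumes "i < length w + 2" "j \<le> length w"
  obtains "i = j" | "i = j + 1" | i' where "i = skip_pair j i'" "i' < length w"
proof (cases "i < j + 2")
  case True
  show thesis
  proof (cases "i < j")
    case True thus thesis using that(3)[of i] assms by (simp add: skip_pair_def)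
  next
    case False thus thesis using that(1,2) \<open>i < j + 2\<close> by linarith
  qed
next
  case False
  hence "i = skip_pair j (i - 2)" "i - 2 < length w" using assms by (auto simp: skip_pair_def)
  thus thesis by (rule that(3))
qed

section \<open>Stirling permutations generated by inserting the largest letter twice\<close>

definition nested :: "nat list \<Rightarrow> bool" where
  "nested w \<longleftrightarrow> (\<forall>i j k. i < j \<and> j < k \<and> k < length w \<and> w ! i = w ! k \<longrightarrow> w ! i \<le> w ! j)"

lemma Q1_eq: "Q1 m = {w. mset w = {#1#} + (\<Sum>i\<in>{2..m}. {#i, i#}) \<and> nested w}"
proof -
  have "(\<forall>i j k. 1 \<le> i \<and> i < j \<and> j < k \<and> k \<le> length w \<and> letter w i = letter w k
       \<longrightarrow> letter w i \<le> letter w j) \<longleftrightarrow> nested w" (is "?L = _") for w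
  proof
    assume ?L
    show "nested w" unfolding nested_def
    proof (intro allI impI)
      fix i j k assume "i < j \<and> j < k \<and> k < length w \<and> w ! i = w ! k"
      thus "w ! i \<le> w ! j" using \<open>?L\<close>[rule_format, of "i + 1" "j + 1" "k + 1"] by (simp add: letter_def)
    qed
  next
    assume N: "nested w"
    show ?L
    proof (intro allI impI)
      fix i j k assume a: "1 \<le> i \<and> i < j \<and> j < k \<and> k \<le> length w \<and> letter w i = letter w k"
      have "i - 1 < j - 1" "j - 1 < k - 1" "k - 1 < length w" using a by linarith+
      moreover have "letter w i = w ! (i - 1)" "letter w j = w ! (j - 1)" "letter w k = w ! (k - 1)"
        using a by (auto simp: letter_def)
      ultimately show "letter w i \<le> letter w j"
        using N a unfolding nested_def by metis
    qed
  qed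
  thus ?thesis unfolding Q1_def stirling_perms_def permutations_of_multiset_def by simp
qed

lemma Q1_length:
  assumes "w \<in> Q1 (n + 1)"
  shows "length w = 2 * n + 1"
proof -
  have "length w = size ({#1#} + (\<Sum>i\<in>{2..n + 1}. {#i, i#}))"
    using Q1_mset[OF assms] size_mset[of w] by metis
  also have "\<dots> = 2 * n + 1" by (simp del: sum.cl_ivl_Suc)
  finally show ?thesis .
qed

lemma Q1_less: "w \<in> Q1 (n + 1) \<Longrightarrow> v \<in> set w \<Longrightarrow> v < n + 2"
  using Q1_set[of w "n + 1"] by auto

lemma Q1_mset_Suc:
  "{#1#} + (\<Sum>i\<in>{2..n + 2}. {#i, i#}) = {#n + 2, n + 2#} + ({#1#} + (\<Sum>i\<in>{2..n + 1}. {#i, i::nat#}))"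
proof -
  have "{2..n + 2} = insert (n + 2) {2..n + 1}" by auto
  thus ?thesis by simp
qed

lemma mset_insert_pair: "mset (insert_pair m j w) = {#m, m#} + mset w"
proof -
  have "mset w = mset (take j w) + mset (drop j w)" by (metis append_take_drop_id mset_append)
  thus ?thesis by (simp add: insert_pair_def)
qed

text \<open>Nothing stands between the two copies of \<open>m\<close>, and between equal old letters
  \<open>m\<close> does no harm because it is larger. Conversely, \<open>w\<close> is a subword, and
  the condition passes to subwords.\<close>

lemma nested_insert_pair:
  assumes "\<And>v. v \<in> set w \<Longrightarrow> v < m" and j: "j \<le> length w"
  shows "nested (insert_pair m j w) \<longleftrightarrow> nested w"
proof
  have less: "w ! i < m" if "i < length w" for i using assms(1) that by simp
  let ?s = "insert_pair m j w"
  have at_j: "?s ! j = m" "?s ! (j + 1) = m" using j by (simp_all add: nth_insert_pair)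
  assume N: "nested w"
  show "nested ?s" unfolding nested_def
  proof (intro allI impI, elim conjE)
    fix a b c assume a: "a < b" "b < c" "c < length ?s" "?s ! a = ?s ! c"
    have len: "a < length w + 2" "b < length w + 2" "c < length w + 2"
      using a by (simp_all add: length_insert_pair)
    show "?s ! a \<le> ?s ! b"
    proof (cases rule: skip_pair_cases[OF len(1) j])
      case (3 a')
      note A = this
      have ne: "?s ! a < m" using A less nth_insert_pair_skip[OF j] by simp
      show ?thesis
      proof (cases rule: skip_pair_cases[OF len(2) j])
        case (3 b')
        note B = this
        show ?thesis
        proof (cases rule: skip_pair_cases[OF len(3) j])
          case (3 c')
          have "a' < b'" "b' < c'" "w ! a' = w ! c'"
            using a A B 3 by (simp_all add: skip_pair_mono nth_insert_pair_skip[OF j])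
          thus ?thesis using N 3(2) A B unfolding nested_def by (simp add: nth_insert_pair_skip[OF j])
        qed (use ne a at_j in auto)
      qed (use ne at_j in auto)
    next
      case 1
      show ?thesis
      proof (cases rule: skip_pair_cases[OF len(3) j])
        case (3 c')
        thus ?thesis using a at_j 1 less[of c'] by (simp add: nth_insert_pair_skip[OF j])
      qed (use 1 a in auto)
    next
      case 2
      show ?thesis
      proof (cases rule: skip_pair_cases[OF len(3) j])
        case (3 c')
        thus ?thesis using a at_j 2 less[of c'] by (simp add: nth_insert_pair_skip[OF j])
      qed (use 2 a in auto)
    qed
  qed
next
  assume N: "nested (insert_pair m j w)"
  show "nested w" unfolding nested_def
  proof (intro allI impI, elim conjE)
    fix a b c assume "a < b" "b < c" "c < length w" "w ! a = w ! c"
    moreover have "skip_pair j c < length (insert_pair m j w)"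
      using \<open>c < length w\<close> j by (simp only: length_insert_pair skip_pair_less)
    ultimately show "w ! a \<le> w ! b"
      using N[unfolded nested_def, rule_format, of "skip_pair j a" "skip_pair j b" "skip_pair j c"] j
      by (simp add: skip_pair_mono nth_insert_pair_skip)
  qed
qed

lemma insert_pair_in_Q1:
  assumes w: "w \<in> Q1 (n + 1)" and j: "j \<le> length w"
  shows "insert_pair (n + 2) j w \<in> Q1 (n + 2)"
  using w nested_insert_pair[OF Q1_less[OF w] j] Q1_mset_Suc[of n]
  unfolding Q1_eq mem_Collect_eq mset_insert_pair by simp

text \<open>The largest letter occurs twice and nothing smaller may stand between its copies, so
  they are adjacent and can be removed together.\<close>

lemma Q1_obtain_insert_pair:
  assumes s: "\<sigma> \<in> Q1 (n + 2)"
  obtains w j where "w \<in> Q1 (n + 1)" "j \<le> length w" "\<sigma> = insert_pair (n + 2) j w"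
proof -
  let ?m = "n + 2"
  have "?m \<in> set \<sigma>" using Q1_set[OF s] by auto
  then obtain u v where uv: "\<sigma> = u @ ?m # v" "?m \<notin> set u" by (meson split_list_first)
  have "count_list \<sigma> ?m = 2" using Q1_count[OF s, of ?m] by simp
  hence cv: "count_list v ?m = 1" using uv by (simp add: count_list_append count_list_0_iff)
  hence "v \<noteq> []" by auto
  then obtain a v' where v: "v = a # v'" by (cases v) auto
  have "a = ?m"
  proof (rule ccontr)
    assume a: "a \<noteq> ?m"
    hence "?m \<in> set v'" using cv v by (metis count_list.simps(2) count_list_0_iff zero_neq_one)
    then obtain k where k: "k < length v'" "v' ! k = ?m" by (auto simp: in_set_conv_nth)
    have N: "nested \<sigma>" using s by (simp add: Q1_eq)
    have "?m \<le> a"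
      using N[unfolded nested_def, rule_format, of "length u" "length u + 1" "length u + 2 + k"] k
      by (simp add: uv v nth_append)
    moreover have "a \<le> ?m" using Q1_set[OF s] uv v by auto
    ultimately show False using a by simp
  qed
  hence e: "\<sigma> = insert_pair ?m (length u) (u @ v')" using uv v by (simp add: insert_pair_def)
  have "{#?m, ?m#} + mset (u @ v') = {#1#} + (\<Sum>i\<in>{2..?m}. {#i, i#})"
    using Q1_mset[OF s] unfolding e mset_insert_pair .
  hence ms: "mset (u @ v') = {#1#} + (\<Sum>i\<in>{2..n + 1}. {#i, i#})"
    unfolding Q1_mset_Suc by (rule add_left_imp_eq)
  have "set (u @ v') = set_mset ({#1#} + (\<Sum>i\<in>{2..n + 1}. {#i, i#}))"
    unfolding ms[symmetric] by (rule set_mset_mset[symmetric])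
  hence less: "x < ?m" if "x \<in> set (u @ v')" for x
    using that by (auto simp: set_mset_sum simp del: sum.cl_ivl_Suc)
  have "nested (u @ v')"
    using s nested_insert_pair[of "u @ v'" ?m "length u", OF less] e by (simp add: Q1_eq)
  hence "u @ v' \<in> Q1 (n + 1)" using ms by (simp only: Q1_eq mem_Collect_eq)
  thus thesis using e by (intro that[of "u @ v'" "length u"]) auto
qed

text \<open>\<open>j\<close> is the number of letters before the first \<open>m\<close>, and
  \<open>w\<close> is what remains after deleting every \<open>m\<close>.\<close>

lemma insert_pair_inj:
  assumes "m \<notin> set w" "m \<notin> set w'" "j \<le> length w" "j' \<le> length w'"
    and e: "insert_pair m j w = insert_pair m j' w'"
  shows "j = j' \<and> w = w'"
proof -
  have tw: "length (takeWhile (\<lambda>x. x \<noteq> m) (insert_pair m j w)) = j" if "m \<notin> set w" "j \<le> length w" for j w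
    using that by (subst insert_pair_def, subst takeWhile_append2) (auto dest: in_set_takeD)
  have f: "filter (\<lambda>x. x \<noteq> m) (insert_pair m j w) = w" if "m \<notin> set w" for j w
  proof -
    have "filter (\<lambda>x. x \<noteq> m) (insert_pair m j w) = filter (\<lambda>x. x \<noteq> m) (take j w @ drop j w)"
      unfolding insert_pair_def filter_append by simp
    also have "\<dots> = w" using that by (auto simp: filter_id_conv)
    finally show ?thesis .
  qed
  show ?thesis using tw[OF assms(1,3)] tw[OF assms(2,4)] f[OF assms(1), of j] f[OF assms(2), of j'] e
    by simp
qed

lemma sum_Q1_Suc:
  "(\<Sum>\<sigma>\<in>Q1 (n + 2). f \<sigma>) = (\<Sum>w\<in>Q1 (n + 1). \<Sum>j\<in>{..2 * n + 1}. f (insert_pair (n + 2) j w))"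
proof -
  let ?P = "Q1 (n + 1) \<times> {..2 * n + 1}"
  have notin: "n + 2 \<notin> set w" if "w \<in> Q1 (n + 1)" for w using Q1_less[OF that] by blast
  have "inj_on (\<lambda>(w, j). insert_pair (n + 2) j w) ?P"
  proof (rule inj_onI, clarify)
    fix w j w' j'
    assume a: "w \<in> Q1 (n + 1)" "w' \<in> Q1 (n + 1)" "j \<le> 2 * n + 1" "j' \<le> 2 * n + 1"
      and "insert_pair (n + 2) j w = insert_pair (n + 2) j' w'"
    thus "w = w' \<and> j = j'"
      using insert_pair_inj[of "n + 2" w w' j j'] notin Q1_length by simp
  qed
  moreover have "(\<lambda>(w, j). insert_pair (n + 2) j w) ` ?P = Q1 (n + 2)"
  proof (intro subset_antisym subsetI)
    fix \<sigma> assume "\<sigma> \<in> Q1 (n + 2)"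
    then obtain w j where "w \<in> Q1 (n + 1)" "j \<le> length w" "\<sigma> = insert_pair (n + 2) j w"
      by (rule Q1_obtain_insert_pair)
    thus "\<sigma> \<in> (\<lambda>(w, j). insert_pair (n + 2) j w) ` ?P"
      using Q1_length by (intro image_eqI[of _ _ "(w, j)"]) auto
  next
    fix \<sigma> assume "\<sigma> \<in> (\<lambda>(w, j). insert_pair (n + 2) j w) ` ?P"
    thus "\<sigma> \<in> Q1 (n + 2)" using insert_pair_in_Q1 Q1_length by auto
  qed
  ultimately show ?thesis
    using sum.reindex[of "\<lambda>(w, j). insert_pair (n + 2) j w" ?P f]
    by (simp only: sum.cartesian_product o_def case_prod_unfold)
qed

section \<open>Stirling statistics as sets of positions\<close>

text \<open>Here positions are counted from 0, unlike in \<open>letter\<close>.\<close>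

definition plateau_at :: "nat list \<Rightarrow> nat \<Rightarrow> bool" where
  "plateau_at w i \<longleftrightarrow> 0 < i \<and> i + 1 < length w \<and> w ! (i - 1) < w ! i \<and> w ! (i + 1) = w ! i"

definition suffix_min_at :: "nat list \<Rightarrow> nat \<Rightarrow> bool" where
  "suffix_min_at w i \<longleftrightarrow> (\<forall>k. i < k \<and> k < length w \<longrightarrow> w ! i \<le> w ! k)"

definition proper_at :: "nat list \<Rightarrow> nat set" where
  "proper_at w = {i. plateau_at w i \<and> \<not> suffix_min_at w i}"

definition improper_at :: "nat list \<Rightarrow> nat set" where
  "improper_at w = {i. plateau_at w i \<and> suffix_min_at w i}"

text \<open>A block ends where the next left-to-right minimum begins. In a word of
  \<open>Q1 m\<close> a block of size 2 is never the last one, as the letter 1 must still follow;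
  hence the smaller letter demanded at \<open>i + 2\<close>.\<close>

definition block2_at :: "nat list \<Rightarrow> nat set" where
  "block2_at w = {i. i + 2 < length w \<and> w ! (i + 1) = w ! i \<and> w ! (i + 2) < w ! i \<and> (\<forall>k<i. w ! i < w ! k)}"

text \<open>Of two plateaux with the same value, the later one is preceded by a smaller letter,
  which would lie between equal letters. Hence positions can be counted instead of values.\<close>

lemma inj_on_plateau:
  assumes w: "nested w"
  shows "inj_on ((!) w) {i. plateau_at w i}"
proof -
  have False if "plateau_at w i" "plateau_at w k" "i < k" "w ! i = w ! k" for i k
  proof (cases "k = i + 1")
    case False
    hence "i < k - 1" "k - 1 < k" "k < length w" using that by (auto simp: plateau_at_def)
    hence "w ! i \<le> w ! (k - 1)" using w that(4) unfolding nested_def by blast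
    thus False using that by (auto simp: plateau_at_def)
  qed (use that in \<open>auto simp: plateau_at_def\<close>)
  thus ?thesis by (auto intro!: inj_onI) (metis linorder_neqE_nat)
qed

lemma letter_Suc: "i < length w \<Longrightarrow> letter w (i + 1) = w ! i"
  by (simp add: letter_def)

lemma Ap_eq: "Ap w = (!) w ` {i. plateau_at w i}"
proof (intro subset_antisym subsetI)
  fix v assume "v \<in> Ap w"
  then obtain i where i: "2 \<le> i" "i \<le> length w - 1" "letter w (i - 1) < letter w i"
    "letter w i = letter w (i + 1)" "v = letter w i" by (auto simp: Ap_def)
  have "letter w i = w ! (i - 1)" "letter w (i - 1) = w ! (i - 1 - 1)" "letter w (i + 1) = w ! (i - 1 + 1)"
    using i(1,2) by (auto simp: letter_def)
  hence "plateau_at w (i - 1)" "v = w ! (i - 1)" using i by (auto simp: plateau_at_def)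
  thus "v \<in> (!) w ` {i. plateau_at w i}" by auto
next
  fix v assume "v \<in> (!) w ` {i. plateau_at w i}"
  then obtain i where i: "plateau_at w i" "v = w ! i" by auto
  have "letter w (i + 1) = w ! i" "letter w (i + 1 - 1) = w ! (i - 1)" "letter w (i + 1 + 1) = w ! (i + 1)"
    using i by (auto simp: letter_def plateau_at_def)
  thus "v \<in> Ap w" unfolding Ap_def using i
    by (intro CollectI exI[of _ "i + 1"]) (auto simp: plateau_at_def)
qed

text \<open>The smaller letter in front of a plateau bars earlier copies of its value. So a plateau
  always starts at a first occurrence, and only the suffix condition of \<open>Rlmin\<close>
  remains.\<close>

lemma Rlmin_iff:
  assumes w: "nested w" and i: "plateau_at w i"
  shows "w ! i \<in> Rlmin w \<longleftrightarrow> suffix_min_at w i"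
proof
  have iL: "i < length w" using i by (simp add: plateau_at_def)
  have first: "w ! k \<noteq> w ! i" if "k < i" for k
  proof
    assume e: "w ! k = w ! i"
    show False
    proof (cases "k = i - 1")
      case False
      hence "k < i - 1" "i - 1 < i" using that by auto
      hence "w ! k \<le> w ! (i - 1)" using w e iL unfolding nested_def by blast
      thus False using e i by (auto simp: plateau_at_def)
    qed (use e i in \<open>auto simp: plateau_at_def\<close>)
  qed
  {
    assume "w ! i \<in> Rlmin w"
    then obtain r where r: "r \<in> {1..length w}" "first_occ w r" "letter w r = w ! i"
      "\<forall>j\<in>{r + 1..length w}. letter w r \<le> letter w j" by (auto simp: Rlmin_def)
    \<comment> \<open>A first occurrence cannot lie to the right of the copy at
      \<open>i + 1\<close>, so minimality after \<open>r\<close> covers all positions after that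
      copy.\<close>
    have "\<not> i + 1 < r" using r(2,3) letter_Suc[OF iL] unfolding first_occ_def
      by (metis Suc_eq_plus1 atLeastLessThan_iff le_add2)
    hence "r - 1 \<le> i" by simp
    show "suffix_min_at w i" unfolding suffix_min_at_def
    proof (intro allI impI)
      fix k assume k: "i < k \<and> k < length w"
      hence "letter w r \<le> letter w (k + 1)" using r(4) \<open>r - 1 \<le> i\<close> by auto
      thus "w ! i \<le> w ! k" using k letter_Suc[of k w] r(3) by simp
    qed
  }
  assume s: "suffix_min_at w i"
  have "letter w j \<noteq> letter w (i + 1)" if "j \<in> {1..<i + 1}" for j
  proof -
    have "j - 1 < i" "letter w j = w ! (j - 1)" using that iL by (auto simp: letter_def)
    thus ?thesis using first letter_Suc[OF iL] by simp
  qed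
  hence "first_occ w (i + 1)" using iL by (auto simp: first_occ_def)
  moreover have "letter w (i + 1) \<le> letter w j" if j: "j \<in> {i + 1 + 1..length w}" for j
  proof -
    have "i < j - 1" "j - 1 < length w" "letter w j = w ! (j - 1)" using j by (auto simp: letter_def)
    thus ?thesis using s letter_Suc[OF iL] by (simp add: suffix_min_at_def)
  qed
  ultimately show "w ! i \<in> Rlmin w" unfolding Rlmin_def
    using iL letter_Suc[OF iL] by (intro CollectI exI[of _ "i + 1"]) auto
qed

lemma Impap_eq: "nested w \<Longrightarrow> Impap w = (!) w ` improper_at w"
  using Rlmin_iff[of w] by (auto simp: Impap_def Ap_eq improper_at_def)

lemma Pap_eq: "nested w \<Longrightarrow> Pap w = (!) w ` proper_at w"
  using Rlmin_iff[of w] by (auto simp: Pap_def Ap_eq proper_at_def)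

lemma impap_eq: "nested w \<Longrightarrow> impap w = card (improper_at w)"
  unfolding impap_def Impap_eq
  by (rule card_image, rule inj_on_subset[OF inj_on_plateau]) (auto simp: improper_at_def)

lemma pap_eq: "nested w \<Longrightarrow> pap w = card (proper_at w)"
  unfolding pap_def Pap_eq
  by (rule card_image, rule inj_on_subset[OF inj_on_plateau]) (auto simp: proper_at_def)

lemma lrmin_positions_Suc:
  "i + 1 \<in> lrmin_positions w \<longleftrightarrow> i < length w \<and> (\<forall>k<i. w ! i < w ! k)"
proof -
  have "(\<forall>j\<in>{1..<i + 1}. letter w (i + 1) < letter w j) \<longleftrightarrow> (\<forall>k<i. w ! i < w ! k)" if i: "i < length w"
  proof
    assume a: "\<forall>j\<in>{1..<i + 1}. letter w (i + 1) < letter w j"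
    show "\<forall>k<i. w ! i < w ! k"
    proof (intro allI impI)
      fix k assume "k < i"
      thus "w ! i < w ! k" using a[rule_format, of "k + 1"] i by (simp add: letter_def)
    qed
  next
    assume a: "\<forall>k<i. w ! i < w ! k"
    show "\<forall>j\<in>{1..<i + 1}. letter w (i + 1) < letter w j"
    proof
      fix j assume "j \<in> {1..<i + 1}"
      hence "j - 1 < i" "letter w j = w ! (j - 1)" using i by (auto simp: letter_def)
      thus "letter w (i + 1) < letter w j" using a letter_Suc[OF i] by simp
    qed
  qed
  thus ?thesis by (cases "i = 0") (auto simp: lrmin_positions_def Suc_le_eq)
qed

text \<open>Every value other than 1 occurs twice. In \<open>blocks2_eq\<close> this excludes a
  block of two different letters.\<close>

lemma Q1_unpaired_False:
  assumes w: "w \<in> Q1 m" and i: "i < length w" and ne: "w ! i \<noteq> 1"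
    and uniq: "\<And>k. k < length w \<Longrightarrow> w ! k = w ! i \<Longrightarrow> k = i"
  shows False
proof -
  have "w ! i \<in> {2..m}" using Q1_set[OF w] nth_mem[OF i] ne by auto
  hence "2 = count_list w (w ! i)" using Q1_count[OF w, of "w ! i"] ne by simp
  also have "\<dots> = card {k. k < length w \<and> w ! k = w ! i}"
    by (simp add: count_list_eq_length_filter length_filter_conv_card eq_commute)
  also have "\<dots> \<le> card {i}" using uniq by (intro card_mono) auto
  finally show False by simp
qed

text \<open>The second letter of a block is at least the first. If it were larger, its other copy
  would lie before the block or after the next left-to-right minimum, and a smaller letter would
  stand between the copies.\<close>

lemma blocks2_eq:
  assumes w: "w \<in> Q1 m"
  shows "blocks2 w = (\<lambda>i. (i + 1, i + 2)) ` block2_at w"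
proof (intro subset_antisym subsetI)
  fix z assume "z \<in> blocks2 w"
  then obtain i' j' where z: "z = (i', j')" "(i', j') \<in> blocks2 w" by (cases z) auto
  note B = blocks2_D[OF z(2)]
  define i where "i = i' - 1"
  have i': "i' = i + 1" "j' = i + 2" using B(1,2) by (auto simp: i_def lrmin_positions_def)
  have lrm: "\<forall>k<i. w ! i < w ! k" using B(2) unfolding i' lrmin_positions_Suc by blast
  have len: "i + 1 < length w" using B(3) by (auto simp: lrmin_factor_def i')
  have lr: "{i + 1..i + 2} \<inter> lrmin_positions w = {i + 1}"
    using B(3) unfolding lrmin_factor_def i' by blast
  have "i + 1 + 1 \<in> {i + 1..i + 2}" "i + 1 + 1 \<noteq> i + 1" by auto
  hence "i + 1 + 1 \<notin> lrmin_positions w" using lr by blast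
  hence "\<exists>k<i + 1. w ! k \<le> w ! (i + 1)" using len lrmin_positions_Suc[of "i + 1" w] by (auto simp: not_less)
  hence ge: "w ! i \<le> w ! (i + 1)" using lrm by (metis less_Suc_eq less_le_trans nless_le Suc_eq_plus1)
  have ge2: "2 \<le> w ! i" using Q1_blocks2_ge2[OF w z(2)] letter_Suc[of i w] len i' by simp
  \<comment> \<open>Otherwise the block ends the word; but all letters up to there are at least
    \<open>w ! i\<close>, hence at least 2, and the letter 1 would be missing.\<close>
  have len2: "i + 2 < length w"
  proof (rule ccontr)
    assume "\<not> i + 2 < length w"
    hence L: "length w = i + 2" using len by simp
    have "1 \<in> set w" using Q1_set[OF w] by simp
    then obtain k where k: "k < length w" "w ! k = 1" by (auto simp: in_set_conv_nth)
    consider "k < i" | "k = i" | "k = i + 1" using k L by linarith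
    thus False using lrm ge ge2 k by cases force+
  qed
  \<comment> \<open>Otherwise the factor could be prolonged by one letter without meeting a further
    left-to-right minimum, contrary to maximality.\<close>
  have "i + 2 + 1 \<in> lrmin_positions w"
  proof (rule ccontr)
    assume "i + 2 + 1 \<notin> lrmin_positions w"
    hence n: "i + 3 \<notin> lrmin_positions w" by (simp add: numeral_3_eq_3)
    have ins: "{i + 1..i + 3} = insert (i + 3) {i + 1..i + 2}" by auto
    have "{i + 1..i + 3} \<inter> lrmin_positions w = {i + 1}"
      unfolding ins Int_insert_left lr using n by simp
    hence "lrmin_factor w (i + 1) (i + 3)" using len2 by (auto simp: lrmin_factor_def)
    hence "{i + 1..i + 2} = {i + 1..i + 3}"
      by (intro B(4)[unfolded i']) auto
    thus False by (simp add: Icc_eq_Icc)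
  qed
  hence lt: "\<forall>k<i + 2. w ! (i + 2) < w ! k" unfolding lrmin_positions_Suc by blast
  have "w ! (i + 1) = w ! i"
  proof (rule ccontr)
    assume "w ! (i + 1) \<noteq> w ! i"
    hence g: "w ! i < w ! (i + 1)" using ge by simp
    have N: "nested w" using w by (simp add: Q1_eq)
    show False
    proof (rule Q1_unpaired_False[OF w len])
      fix k assume k: "k < length w" "w ! k = w ! (i + 1)"
      show "k = i + 1"
      proof (rule ccontr)
        assume "k \<noteq> i + 1"
        moreover have "k \<noteq> i" "k \<noteq> i + 2" using k g lt by auto
        ultimately consider "k < i" | "i + 2 < k" by linarith
        thus False
        proof cases
          case 1
          hence "w ! k \<le> w ! i" using N k len unfolding nested_def by (metis less_add_one)
          thus False using g k by simp
        next
          case 2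
          hence "w ! (i + 1) \<le> w ! (i + 2)" using N k unfolding nested_def by (metis add_less_cancel_left one_less_numeral_iff semiring_norm(76))
          thus False using lt[rule_format, of "i + 1"] by simp
        qed
      qed
    qed (use g ge2 in simp)
  qed
  hence "i \<in> block2_at w" using len2 lt lrm by (auto simp: block2_at_def)
  thus "z \<in> (\<lambda>i. (i + 1, i + 2)) ` block2_at w" using z i' by auto
next
  fix z assume "z \<in> (\<lambda>i. (i + 1, i + 2)) ` block2_at w"
  then obtain i where z: "z = (i + 1, i + 2)" and i: "i + 2 < length w" "w ! (i + 1) = w ! i"
    "w ! (i + 2) < w ! i" "\<forall>k<i. w ! i < w ! k" by (auto simp: block2_at_def)
  have 1: "i + 1 \<in> lrmin_positions w" using i lrmin_positions_Suc[of i w] by simp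
  have 2: "i + 2 \<notin> lrmin_positions w" using i lrmin_positions_Suc[of "i + 1" w] by auto
  have "w ! (i + 2) < w ! k" if "k < i + 2" for k
  proof -
    consider "k < i" | "k = i" | "k = i + 1" using \<open>k < i + 2\<close> by linarith
    thus ?thesis using i by cases auto
  qed
  hence 3: "i + 3 \<in> lrmin_positions w" using i lrmin_positions_Suc[of "i + 2" w] by (simp add: numeral_3_eq_3)
  have "{i + 1..i + 2} = {i + 1, i + 2}" by auto
  hence f: "lrmin_factor w (i + 1) (i + 2)" using 1 2 i by (auto simp: lrmin_factor_def)
  have "{i + 1..i + 2} = {a..b}" if ab: "lrmin_factor w a b" "{i + 1..i + 2} \<subseteq> {a..b}" for a b
  proof -
    have s: "a \<le> i + 1" "i + 2 \<le> b" "{a..b} \<inter> lrmin_positions w = {a}"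
      using ab by (auto simp: lrmin_factor_def)
    have "i + 1 \<in> {a..b}" using s by auto
    hence "i + 1 = a" using s(3) 1 by blast
    moreover have "i + 3 \<notin> {a..b}"
    proof
      assume "i + 3 \<in> {a..b}"
      hence "i + 3 \<in> {a}" using 3 unfolding s(3)[symmetric] by (rule IntI)
      thus False using \<open>i + 1 = a\<close> by simp
    qed
    hence "b = i + 2" using s by auto
    ultimately show ?thesis by simp
  qed
  hence "(i + 1, i + 2) \<in> blocks w" using f by (auto simp: blocks_def)
  thus "z \<in> blocks2 w" using z by (simp add: blocks2_def)
qed

lemma bk2_eq: "w \<in> Q1 m \<Longrightarrow> bk2 w = card (block2_at w)"
  unfolding bk2_def by (simp add: blocks2_eq card_image inj_on_def)

section \<open>Effect of an insertion on plateaux and blocks\<close>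

context
  fixes m j :: nat and w :: "nat list"
  assumes less: "\<forall>v\<in>set w. v < m" and j: "j \<le> length w"
begin

lemma nth_less: "i < length w \<Longrightarrow> w ! i < m"
  using less by simp

lemma Collect_positions_insert_pair:
  assumes "\<And>i. P i \<Longrightarrow> i < length w + 2"
  shows "{i. P i} = skip_pair j ` {i. i < length w \<and> P (skip_pair j i)}
    \<union> (if P j then {j} else {}) \<union> (if P (j + 1) then {j + 1} else {})"
  (is "?L = ?R")
proof (intro subset_antisym subsetI)
  fix i assume "i \<in> ?L"
  hence i: "P i" by simp
  show "i \<in> ?R" by (rule skip_pair_cases[OF assms[OF i] j]) (use i in auto)
qed (auto split: if_splits)

text \<open>Gap \<open>i\<close> separates a plateau from its smaller predecessor and gap
  \<open>i + 1\<close> separates its two letters; all other gaps leave it intact. The first new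
  letter only needs a predecessor, and the second is preceded by an equal letter.\<close>

lemma plateau_at_insert_pair:
  "i < length w \<Longrightarrow> plateau_at (insert_pair m j w) (skip_pair j i) \<longleftrightarrow> plateau_at w i \<and> j \<noteq> i \<and> j \<noteq> i + 1"
  "plateau_at (insert_pair m j w) j \<longleftrightarrow> 0 < j"
  "\<not> plateau_at (insert_pair m j w) (j + 1)"
proof -
  assume i: "i < length w"
  consider "i + 1 < j" | "i + 1 = j" | "i = j" | "j < i" by linarith
  thus "plateau_at (insert_pair m j w) (skip_pair j i) \<longleftrightarrow> plateau_at w i \<and> j \<noteq> i \<and> j \<noteq> i + 1"
  proof cases
    case 2
    thus ?thesis using nth_less[OF i] j
      by (auto simp: plateau_at_def skip_pair_def nth_insert_pair length_insert_pair)
  next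
    case 3
    thus ?thesis using nth_less[OF i] j
      by (auto simp: plateau_at_def skip_pair_def nth_insert_pair length_insert_pair)
  next
    case 4
    hence "i + 2 - 1 - 2 = i - 1" by simp
    thus ?thesis using 4 j i
      by (auto simp: plateau_at_def skip_pair_def nth_insert_pair length_insert_pair)
  qed (use j i in \<open>auto simp: plateau_at_def skip_pair_def nth_insert_pair length_insert_pair\<close>)
next
  show "plateau_at (insert_pair m j w) j \<longleftrightarrow> 0 < j"
    using j nth_less[of "j - 1"] by (auto simp: plateau_at_def nth_insert_pair length_insert_pair)
  show "\<not> plateau_at (insert_pair m j w) (j + 1)"
    using j by (auto simp: plateau_at_def nth_insert_pair length_insert_pair)
qed

text \<open>The inserted letter is too large to spoil a suffix minimum of the old word, and is one
  itself only when no old letter follows.\<close>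

lemma suffix_min_at_insert_pair:
  "i < length w \<Longrightarrow> suffix_min_at (insert_pair m j w) (skip_pair j i) \<longleftrightarrow> suffix_min_at w i"
  "suffix_min_at (insert_pair m j w) j \<longleftrightarrow> j = length w"
proof -
  assume i: "i < length w"
  show "suffix_min_at (insert_pair m j w) (skip_pair j i) \<longleftrightarrow> suffix_min_at w i"
  proof
    assume s: "suffix_min_at (insert_pair m j w) (skip_pair j i)"
    show "suffix_min_at w i" unfolding suffix_min_at_def
    proof (intro allI impI)
      fix k assume "i < k \<and> k < length w"
      hence "skip_pair j i < skip_pair j k" "skip_pair j k < length (insert_pair m j w)"
        using skip_pair_less[OF j, of k] by (simp_all add: skip_pair_mono length_insert_pair)
      thus "w ! i \<le> w ! k" using s unfolding suffix_min_at_def by (metis nth_insert_pair_skip[OF j])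
    qed
  next
    assume s: "suffix_min_at w i"
    show "suffix_min_at (insert_pair m j w) (skip_pair j i)" unfolding suffix_min_at_def
    proof (intro allI impI)
      fix k assume k: "skip_pair j i < k \<and> k < length (insert_pair m j w)"
      hence k': "k < length w + 2" by (simp add: length_insert_pair)
      show "insert_pair m j w ! skip_pair j i \<le> insert_pair m j w ! k"
        unfolding nth_insert_pair_skip[OF j]
      proof (rule skip_pair_cases[OF k' j])
        fix k' assume "k = skip_pair j k'" "k' < length w"
        thus "w ! i \<le> insert_pair m j w ! k"
          using s k by (simp add: suffix_min_at_def skip_pair_mono nth_insert_pair_skip[OF j])
      qed (use nth_less[OF i] j in \<open>auto simp: nth_insert_pair\<close>)
    qed
  qed
next
  show "suffix_min_at (insert_pair m j w) j \<longleftrightarrow> j = length w"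
  proof
    assume s: "suffix_min_at (insert_pair m j w) j"
    show "j = length w"
    proof (rule ccontr)
      assume "j \<noteq> length w"
      hence "j < length w" using j by simp
      hence "m \<le> w ! j"
        using s[unfolded suffix_min_at_def, rule_format, of "j + 2"] j
        by (simp add: nth_insert_pair length_insert_pair)
      thus False using nth_less[OF \<open>j < length w\<close>] by simp
    qed
  qed (auto simp: suffix_min_at_def nth_insert_pair length_insert_pair)
qed

text \<open>Gap \<open>i + 1\<close> splits the two letters and gap \<open>i + 2\<close> lengthens
  the block. A pair further left is larger than \<open>w ! i\<close>, so the block still starts with
  a left-to-right minimum.\<close>

lemma block2_at_insert_pair_skip:
  assumes i: "i < length w"
  shows "skip_pair j i \<in> block2_at (insert_pair m j w) \<longleftrightarrow> i \<in> block2_at w \<and> j \<noteq> i + 1 \<and> j \<noteq> i + 2"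
proof -
  have pre: "(\<forall>k<skip_pair j i. w ! i < insert_pair m j w ! k) \<longleftrightarrow> (\<forall>k<i. w ! i < w ! k)"
  proof
    assume a: "\<forall>k<skip_pair j i. w ! i < insert_pair m j w ! k"
    show "\<forall>k<i. w ! i < w ! k"
      using a skip_pair_mono[of j _ i] nth_insert_pair_skip[OF j, of m] by metis
  next
    assume a: "\<forall>k<i. w ! i < w ! k"
    show "\<forall>k<skip_pair j i. w ! i < insert_pair m j w ! k"
    proof (intro allI impI)
      fix k assume k: "k < skip_pair j i"
      hence k': "k < length w + 2" using skip_pair_less[OF j, of i] i by simp
      show "w ! i < insert_pair m j w ! k"
      proof (rule skip_pair_cases[OF k' j])
        fix k' assume "k = skip_pair j k'" "k' < length w"
        thus ?thesis using a k by (simp add: skip_pair_mono nth_insert_pair_skip[OF j])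
      qed (use nth_less[OF i] j in \<open>auto simp: nth_insert_pair\<close>)
    qed
  qed
  consider "i + 2 < j" | "i + 2 = j" | "i + 1 = j" | "j \<le> i" by linarith
  thus ?thesis unfolding block2_at_def mem_Collect_eq nth_insert_pair_skip[OF j] pre
  proof cases
    case 2
    thus "(skip_pair j i + 2 < length (insert_pair m j w) \<and> insert_pair m j w ! (skip_pair j i + 1) = w ! i \<and>
      insert_pair m j w ! (skip_pair j i + 2) < w ! i \<and> (\<forall>k<i. w ! i < w ! k)) =
      ((i + 2 < length w \<and> w ! (i + 1) = w ! i \<and> w ! (i + 2) < w ! i \<and> (\<forall>k<i. w ! i < w ! k)) \<and> j \<noteq> i + 1 \<and> j \<noteq> i + 2)"
      using nth_less[OF i] j by (auto simp: skip_pair_def nth_insert_pair)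
  next
    case 3
    thus "(skip_pair j i + 2 < length (insert_pair m j w) \<and> insert_pair m j w ! (skip_pair j i + 1) = w ! i \<and>
      insert_pair m j w ! (skip_pair j i + 2) < w ! i \<and> (\<forall>k<i. w ! i < w ! k)) =
      ((i + 2 < length w \<and> w ! (i + 1) = w ! i \<and> w ! (i + 2) < w ! i \<and> (\<forall>k<i. w ! i < w ! k)) \<and> j \<noteq> i + 1 \<and> j \<noteq> i + 2)"
      using nth_less[OF i] j by (auto simp: skip_pair_def nth_insert_pair)
  qed (use j in \<open>auto simp: skip_pair_def nth_insert_pair length_insert_pair\<close>)
qed

lemma proper_at_insert_pair:
  "proper_at (insert_pair m j w) = skip_pair j ` {i \<in> proper_at w. j \<noteq> i \<and> j \<noteq> i + 1}
     \<union> (if 0 < j \<and> j < length w then {j} else {})"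
proof -
  have "i < length w + 2" if "plateau_at (insert_pair m j w) i \<and> \<not> suffix_min_at (insert_pair m j w) i" for i
    using that by (simp add: plateau_at_def length_insert_pair)
  note C = Collect_positions_insert_pair[of "\<lambda>i. plateau_at (insert_pair m j w) i \<and> \<not> suffix_min_at (insert_pair m j w) i", OF this]
  have "{i. i < length w \<and> plateau_at (insert_pair m j w) (skip_pair j i) \<and> \<not> suffix_min_at (insert_pair m j w) (skip_pair j i)}
     = {i \<in> proper_at w. j \<noteq> i \<and> j \<noteq> i + 1}"
    using plateau_at_insert_pair(1) suffix_min_at_insert_pair(1)
    by (auto simp: proper_at_def) (auto simp: plateau_at_def)
  thus ?thesis using C plateau_at_insert_pair(2,3) suffix_min_at_insert_pair(2) j
    unfolding proper_at_def[of "insert_pair m j w"] by simp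
qed

lemma improper_at_insert_pair:
  "improper_at (insert_pair m j w) = skip_pair j ` {i \<in> improper_at w. j \<noteq> i \<and> j \<noteq> i + 1}
     \<union> (if 0 < j \<and> j = length w then {j} else {})"
proof -
  have "i < length w + 2" if "plateau_at (insert_pair m j w) i \<and> suffix_min_at (insert_pair m j w) i" for i
    using that by (simp add: plateau_at_def length_insert_pair)
  note C = Collect_positions_insert_pair[of "\<lambda>i. plateau_at (insert_pair m j w) i \<and> suffix_min_at (insert_pair m j w) i", OF this]
  have "{i. i < length w \<and> plateau_at (insert_pair m j w) (skip_pair j i) \<and> suffix_min_at (insert_pair m j w) (skip_pair j i)}
     = {i \<in> improper_at w. j \<noteq> i \<and> j \<noteq> i + 1}"
    using plateau_at_insert_pair(1) suffix_min_at_insert_pair(1)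
    by (auto simp: improper_at_def) (auto simp: plateau_at_def)
  thus ?thesis using C plateau_at_insert_pair(2,3) suffix_min_at_insert_pair(2) j
    unfolding improper_at_def[of "insert_pair m j w"] by simp
qed

text \<open>Its letter being the largest, the new pair starts with a left-to-right minimum only in
  the first gap; a smaller letter follows it there because \<open>w\<close> is nonempty.\<close>

lemma block2_at_insert_pair:
  assumes "w \<noteq> []"
  shows "block2_at (insert_pair m j w) = skip_pair j ` {i \<in> block2_at w. j \<noteq> i + 1 \<and> j \<noteq> i + 2}
     \<union> (if j = 0 then {0} else {})"
proof -
  have "i < length w + 2" if "i \<in> block2_at (insert_pair m j w)" for i
    using that by (simp add: block2_at_def length_insert_pair)
  note C = Collect_positions_insert_pair[of "\<lambda>i. i \<in> block2_at (insert_pair m j w)", OF this]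
  have "{i. i < length w \<and> skip_pair j i \<in> block2_at (insert_pair m j w)} = {i \<in> block2_at w. j \<noteq> i + 1 \<and> j \<noteq> i + 2}"
  proof -
    have "i < length w" if "i \<in> block2_at w" for i using that by (simp add: block2_at_def)
    thus ?thesis using block2_at_insert_pair_skip by auto
  qed
  moreover have "j \<in> block2_at (insert_pair m j w) \<longleftrightarrow> j = 0"
  proof
    assume "j \<in> block2_at (insert_pair m j w)"
    hence all: "m < insert_pair m j w ! k" if "k < j" for k
      using that j unfolding block2_at_def mem_Collect_eq
      by (metis (no_types) less_irrefl nth_insert_pair[OF j] zero_less_numeral less_add_same_cancel1)
    show "j = 0"
    proof (rule ccontr)
      assume "j \<noteq> 0"
      hence "m < w ! 0" using all[of 0] j by (simp add: nth_insert_pair)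
      moreover have "w ! 0 < m" using assms by (intro nth_less) simp
      ultimately show False by simp
    qed
  next
    assume "j = 0"
    moreover have "w ! 0 < m" using assms by (intro nth_less) simp
    ultimately show "j \<in> block2_at (insert_pair m j w)"
      using assms by (simp add: block2_at_def nth_insert_pair length_insert_pair)
  qed
  moreover have "j + 1 \<notin> block2_at (insert_pair m j w)"
  proof
    assume "j + 1 \<in> block2_at (insert_pair m j w)"
    hence "j < length w" "w ! j = m" using j by (auto simp: block2_at_def nth_insert_pair length_insert_pair)
    thus False using nth_less by auto
  qed
  ultimately show ?thesis using C by simp
qed

end

section \<open>First occurrences at even positions, and the trace\<close>

text \<open>An even position in the count from 1 is an odd index here.\<close>

definition even_values :: "nat list \<Rightarrow> nat set" where
  "even_values w = {v. \<exists>i<length w. odd i \<and> w ! i = v \<and> (\<forall>k<i. w ! k \<noteq> v)}"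

lemma even_stat_eq: "even_stat w = card (even_values w)"
proof -
  have "(\<exists>i. first_occ w i \<and> letter w i = v \<and> even i) \<longleftrightarrow> v \<in> even_values w" for v
  proof
    assume "\<exists>i. first_occ w i \<and> letter w i = v \<and> even i"
    then obtain i where i: "first_occ w i" "letter w i = v" "even i" by blast
    hence i1: "1 \<le> i" "i \<le> length w" by (auto simp: first_occ_def)
    have "w ! k \<noteq> v" if "k < i - 1" for k
    proof -
      have "k + 1 \<in> {1..<i}" using that by auto
      hence "letter w (k + 1) \<noteq> v" using i by (auto simp: first_occ_def)
      thus ?thesis using that i1 letter_Suc[of k w] by simp
    qed
    moreover have "odd (i - 1)" "i - 1 < length w" "w ! (i - 1) = v"
      using i i1 by (auto simp: letter_def)
    ultimately show "v \<in> even_values w" unfolding even_values_def by blast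
  next
    assume "v \<in> even_values w"
    then obtain i where i: "i < length w" "odd i" "w ! i = v" "\<forall>k<i. w ! k \<noteq> v"
      by (auto simp: even_values_def)
    have "letter w k \<noteq> letter w (i + 1)" if "k \<in> {1..<i + 1}" for k
    proof -
      have "k - 1 < i" "letter w k = w ! (k - 1)" using that i by (auto simp: letter_def)
      thus ?thesis using i letter_Suc[OF i(1)] by simp
    qed
    thus "\<exists>i. first_occ w i \<and> letter w i = v \<and> even i"
      using i letter_Suc[OF i(1)] by (intro exI[of _ "i + 1"]) (auto simp: first_occ_def)
  qed
  thus ?thesis by (simp add: even_stat_def)
qed

lemma even_values_subset: "even_values w \<subseteq> set w"
  by (auto simp: even_values_def)

text \<open>Old letters move by 0 or 2 places, so all parities survive, and the new value first
  occurs at index \<open>j\<close>.\<close>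

lemma even_values_insert_pair:
  assumes less: "\<forall>v\<in>set w. v < m" and j: "j \<le> length w"
  shows "even_values (insert_pair m j w) = even_values w \<union> (if odd j then {m} else {})"
proof (intro subset_antisym subsetI)
  let ?s = "insert_pair m j w"
  have par: "odd (skip_pair j i) \<longleftrightarrow> odd i" for i by (simp add: skip_pair_def)
  have at_j: "?s ! j = m" "?s ! (j + 1) = m" using j by (simp_all add: nth_insert_pair)
  {
    fix v assume "v \<in> even_values ?s"
    then obtain i where i: "i < length ?s" "odd i" "?s ! i = v" "\<forall>k<i. ?s ! k \<noteq> v"
      by (auto simp: even_values_def)
    have i': "i < length w + 2" using i by (simp add: length_insert_pair)
    show "v \<in> even_values w \<union> (if odd j then {m} else {})"
    proof (rule skip_pair_cases[OF i' j])
      fix i' assume i'': "i = skip_pair j i'" "i' < length w"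
      have "w ! k \<noteq> v" if "k < i'" for k
        using i(4)[rule_format, of "skip_pair j k"] that i'' by (simp add: skip_pair_mono nth_insert_pair_skip[OF j])
      hence "v \<in> even_values w" using i i'' par unfolding even_values_def
        by (auto simp: nth_insert_pair_skip[OF j])
      thus ?thesis by simp
    qed (use i at_j in auto)
  }
  fix v assume v: "v \<in> even_values w \<union> (if odd j then {m} else {})"
  show "v \<in> even_values ?s"
  proof (cases "v \<in> even_values w")
    case True
    then obtain i where i: "i < length w" "odd i" "w ! i = v" "\<forall>k<i. w ! k \<noteq> v"
      by (auto simp: even_values_def)
    have "v < m" using i less by auto
    have "?s ! k \<noteq> v" if k: "k < skip_pair j i" for k
    proof -
      have k': "k < length w + 2" using k skip_pair_less[OF j, of i] i by simp
      show ?thesis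
      proof (rule skip_pair_cases[OF k' j])
        fix k' assume "k = skip_pair j k'" "k' < length w"
        thus ?thesis using k i by (simp add: skip_pair_mono nth_insert_pair_skip[OF j])
      qed (use at_j \<open>v < m\<close> in auto)
    qed
    moreover have "skip_pair j i < length ?s" using skip_pair_less[OF j, of i] i by (simp add: length_insert_pair)
    ultimately show ?thesis unfolding even_values_def using i par
      by (intro CollectI exI[of _ "skip_pair j i"]) (auto simp: nth_insert_pair_skip[OF j])
  next
    case False
    hence "odd j" "v = m" using v by (auto split: if_splits)
    moreover have "?s ! k \<noteq> m" if "k < j" for k
      using bspec[OF less, of "w ! k"] that j by (simp add: nth_insert_pair)
    ultimately show ?thesis unfolding even_values_def using j at_j
      by (intro CollectI exI[of _ j]) (auto simp: length_insert_pair)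
  qed
qed

definition trace_step :: "nat list \<Rightarrow> nat set" where
  "trace_step w = Impap w \<union> {v. \<exists>(i, j) \<in> blocks2 w. v = letter w j}"

lemma Trace_eq: "Trace m w = (\<Union>k\<in>{2..m}. trace_step (restrict_word w k))"
  by (auto simp: Trace_def trace_step_def)

lemma trace_step_subset: "trace_step w \<subseteq> set w"
proof
  fix v assume "v \<in> trace_step w"
  then consider "v \<in> Ap w" | i j where "(i, j) \<in> blocks2 w" "v = letter w j"
    by (auto simp: trace_step_def Impap_def)
  thus "v \<in> set w"
  proof cases
    case 1
    thus ?thesis by (auto simp: Ap_eq plateau_at_def)
  next
    case 2
    have "lrmin_factor w i j" by (rule blocks2_D(3)[OF 2(1)])
    thus ?thesis using 2(2) by (auto simp: lrmin_factor_def intro: letter_in_set)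
  qed
qed

lemma trace_step_Q1:
  assumes w: "w \<in> Q1 m"
  shows "trace_step w = (!) w ` (improper_at w \<union> block2_at w)"
proof -
  have "nested w" using w by (simp add: Q1_eq)
  moreover have "letter w (i + 2) = w ! i" if "i \<in> block2_at w" for i
    using that by (simp add: block2_at_def letter_def)
  hence "{v. \<exists>(i, j) \<in> blocks2 w. v = letter w j} = (!) w ` block2_at w"
    unfolding blocks2_eq[OF w] by auto
  ultimately show ?thesis by (simp add: trace_step_def Impap_eq image_Un)
qed

lemma Trace_subset: "Trace m w \<subseteq> set w"
proof -
  have "set (restrict_word w k) \<subseteq> set w" for k by (auto simp: restrict_word_def)
  thus ?thesis unfolding Trace_eq using trace_step_subset by blast
qed

lemma restrict_word_Q1: "w \<in> Q1 (n + 1) \<Longrightarrow> restrict_word w (n + 1) = w"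
  using Q1_less[of w n] by (force simp: restrict_word_def filter_id_conv)

lemma restrict_word_insert_pair: "k < m \<Longrightarrow> restrict_word (insert_pair m j w) k = restrict_word w k"
  using filter_append[of "\<lambda>a. a \<le> k" "take j w" "drop j w"]
  by (simp add: restrict_word_def insert_pair_def)

text \<open>Restrictions to letters below \<open>n + 2\<close> do not see the new pair. The full new
  word adds at most the new letter, since its surviving improper plateaux and blocks are in
  \<open>Trace (n + 1) w\<close> already; the trace also keeps the values of destroyed ones. So it
  grows only at the outer gaps, just as \<open>cyc\<close> grows only with a new cycle.\<close>

lemma Trace_insert_pair:
  assumes w: "w \<in> Q1 (n + 1)" and j: "j \<le> length w"
  shows "Trace (n + 2) (insert_pair (n + 2) j w)
    = Trace (n + 1) w \<union> (if j = 0 \<or> j = length w then {n + 2} else {})"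
proof -
  let ?m = "n + 2" and ?s = "insert_pair (n + 2) j w"
  have less: "\<forall>v\<in>set w. v < n + 2" using Q1_less[OF w] by blast
  have ne: "w \<noteq> []" using Q1_length[OF w] by auto
  have s: "?s \<in> Q1 (n + 2)" by (rule insert_pair_in_Q1[OF w j])
  have sub: "trace_step w \<subseteq> Trace (n + 1) w"
  \<comment> \<open>For \<open>n = 0\<close> the union that forms the trace is empty, but then the
    one-letter word has neither plateaux nor blocks of size 2.\<close>
  proof (cases "n = 0")
    case True
    hence "improper_at w = {}" "block2_at w = {}"
      using Q1_length[OF w] by (auto simp: improper_at_def block2_at_def plateau_at_def)
    thus ?thesis by (simp add: trace_step_Q1[OF w])
  next
    case False
    hence "n + 1 \<in> {2..n + 1}" by auto
    hence "trace_step (restrict_word w (n + 1)) \<subseteq> Trace (n + 1) w"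
      unfolding Trace_eq by (rule UN_upper)
    thus ?thesis by (simp only: restrict_word_Q1[OF w])
  qed
  have "{2..?m} = insert ?m {2..n + 1}" by auto
  hence "Trace ?m ?s = trace_step (restrict_word ?s ?m) \<union> (\<Union>k\<in>{2..n + 1}. trace_step (restrict_word ?s k))"
    unfolding Trace_eq by simp
  also have "restrict_word ?s ?m = ?s" using restrict_word_Q1[of ?s "n + 1"] s by simp
  also have "(\<Union>k\<in>{2..n + 1}. trace_step (restrict_word ?s k)) = Trace (n + 1) w"
    unfolding Trace_eq by (intro SUP_cong) (auto simp: restrict_word_insert_pair)
  finally have T: "Trace ?m ?s = trace_step ?s \<union> Trace (n + 1) w" .
  have at_j: "?s ! j = ?m" using j by (simp add: nth_insert_pair)
  have ts: "trace_step ?s = (!) w ` ({i \<in> improper_at w. j \<noteq> i \<and> j \<noteq> i + 1} \<union> {i \<in> block2_at w. j \<noteq> i + 1 \<and> j \<noteq> i + 2})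
      \<union> (if j = 0 \<or> j = length w then {?m} else {})"
    unfolding trace_step_Q1[OF s] improper_at_insert_pair[OF less j] block2_at_insert_pair[OF less j ne]
    using at_j ne by (auto simp: image_Un image_image nth_insert_pair_skip[OF j] split: if_splits)
  have "(!) w ` ({i \<in> improper_at w. j \<noteq> i \<and> j \<noteq> i + 1} \<union> {i \<in> block2_at w. j \<noteq> i + 1 \<and> j \<noteq> i + 2}) \<subseteq> Trace (n + 1) w"
    using sub unfolding trace_step_Q1[OF w] by blast
  thus ?thesis unfolding T ts by blast
qed

section \<open>Recurrence for Stirling permutations\<close>

lemma finite_positions: "finite (proper_at w)" "finite (improper_at w)" "finite (block2_at w)"
  by (rule finite_subset[of _ "{..<length w}"]; force simp: proper_at_def improper_at_def block2_at_def plateau_at_def)+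

lemma card_skip_pair_Un:
  assumes "finite X" "j \<notin> skip_pair j ` X"
  shows "card (skip_pair j ` X \<union> (if b then {j} else {})) = card X + (if b then 1 else 0)"
  using assms card_image[OF inj_on_subset[OF inj_skip_pair subset_UNIV], of j X] by auto

lemma j_notin_skip_pair: "j \<notin> skip_pair j ` X"
  by (auto simp: skip_pair_def)

lemma stats_insert_pair:
  assumes w: "w \<in> Q1 (n + 1)" and j: "j \<le> 2 * n + 1"
  defines "\<sigma> \<equiv> insert_pair (n + 2) j w"
  shows "pap \<sigma> = card {i \<in> proper_at w. j \<noteq> i \<and> j \<noteq> i + 1} + (if 0 < j \<and> j < 2 * n + 1 then 1 else 0)"
    and "impap \<sigma> = card {i \<in> improper_at w. j \<noteq> i \<and> j \<noteq> i + 1} + (if j = 2 * n + 1 then 1 else 0)"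
    and "bk2 \<sigma> = card {i \<in> block2_at w. j \<noteq> i + 1 \<and> j \<noteq> i + 2} + (if j = 0 then 1 else 0)"
    and "even_stat \<sigma> = even_stat w + (if odd j then 1 else 0)"
    and "tr (n + 2) \<sigma> = tr (n + 1) w + (if j = 0 \<or> j = 2 * n + 1 then 1 else 0)"
proof -
  have less: "\<forall>v\<in>set w. v < n + 2" using Q1_less[OF w] by blast
  note L = Q1_length[OF w]
  have j': "j \<le> length w" and ne: "w \<noteq> []" using j L by auto
  have s: "\<sigma> \<in> Q1 (n + 2)" unfolding \<sigma>_def by (rule insert_pair_in_Q1[OF w j'])
  have N: "nested \<sigma>" using s by (simp add: Q1_eq)
  have notin: "n + 2 \<notin> set w" using less by blast
  show "pap \<sigma> = card {i \<in> proper_at w. j \<noteq> i \<and> j \<noteq> i + 1} + (if 0 < j \<and> j < 2 * n + 1 then 1 else 0)"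
    unfolding pap_eq[OF N] unfolding \<sigma>_def proper_at_insert_pair[OF less j'] L
    by (subst card_skip_pair_Un) (auto simp: finite_positions j_notin_skip_pair)
  have "(0 < j \<and> j = length w) = (j = 2 * n + 1)" using L by auto
  thus "impap \<sigma> = card {i \<in> improper_at w. j \<noteq> i \<and> j \<noteq> i + 1} + (if j = 2 * n + 1 then 1 else 0)"
    unfolding impap_eq[OF N] unfolding \<sigma>_def improper_at_insert_pair[OF less j']
    by (subst card_skip_pair_Un) (auto simp: finite_positions j_notin_skip_pair)
  have j0: "(if j = 0 then {0} else {}) = (if j = 0 then {j} else {})" by simp
  show "bk2 \<sigma> = card {i \<in> block2_at w. j \<noteq> i + 1 \<and> j \<noteq> i + 2} + (if j = 0 then 1 else 0)"
    unfolding bk2_eq[OF s] unfolding \<sigma>_def block2_at_insert_pair[OF less j' ne] j0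
    by (subst card_skip_pair_Un) (auto simp: finite_positions j_notin_skip_pair)
  have "finite (even_values w)" "n + 2 \<notin> even_values w"
    using even_values_subset[of w] notin finite_subset by auto
  thus "even_stat \<sigma> = even_stat w + (if odd j then 1 else 0)"
    unfolding even_stat_eq \<sigma>_def even_values_insert_pair[OF less j'] by simp
  have "finite (Trace (n + 1) w)" "n + 2 \<notin> Trace (n + 1) w"
    using Trace_subset[of "n + 1" w] notin finite_subset by auto
  thus "tr (n + 2) \<sigma> = tr (n + 1) w + (if j = 0 \<or> j = 2 * n + 1 then 1 else 0)"
    unfolding tr_def \<sigma>_def Trace_insert_pair[OF w j'] L by simp
qed

lemma card_parity_class: "card {j \<in> {1..2 * n}. odd j = b} = n"
proof (induction n)
  case (Suc n)
  have "{j \<in> {1..2 * Suc n}. odd j = b}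
      = insert (if b then 2 * n + 1 else 2 * n + 2) {j \<in> {1..2 * n}. odd j = b}"
    by (auto simp: le_Suc_eq)
  thus ?case using Suc by simp
qed simp

lemma sum_parity_split:
  fixes F :: "nat \<Rightarrow> 'a :: comm_monoid_add"
  shows "(\<Sum>j\<in>{..2 * n + 1}. F j) = F 0 + F (2 * n + 1)
    + (\<Sum>j\<in>{j \<in> {1..2 * n}. odd j = False}. F j) + (\<Sum>j\<in>{j \<in> {1..2 * n}. odd j = True}. F j)"
proof -
  have e: "{..2 * n + 1} = insert 0 (insert (2 * n + 1)
      ({j \<in> {1..2 * n}. odd j = False} \<union> {j \<in> {1..2 * n}. odd j = True}))" by force
  have "(\<Sum>j\<in>{j \<in> {1..2 * n}. odd j = False} \<union> {j \<in> {1..2 * n}. odd j = True}. F j)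
    = (\<Sum>j\<in>{j \<in> {1..2 * n}. odd j = False}. F j) + (\<Sum>j\<in>{j \<in> {1..2 * n}. odd j = True}. F j)"
    by (rule sum.union_disjoint) auto
  thus ?thesis unfolding e by (subst sum.insert, simp, simp, subst sum.insert) (auto simp: add_ac)
qed

text \<open>One parity class has \<open>n\<close> inner gaps, and each owner holds exactly one of
  them. \<open>E\<close>, \<open>C\<close> and \<open>D\<close> are the gaps owned by proper
  plateaux, improper plateaux and blocks; \<open>A\<close> collects the \<open>cap n w\<close> free
  ones. Destroying the owner of \<open>j\<close> amounts to removing \<open>j\<close> from its
  class, so \<open>sum_remove_from_class\<close> applies.\<close>

lemma sum_interior_gaps:
  fixes h :: "nat \<Rightarrow> nat \<Rightarrow> nat \<Rightarrow> nat \<Rightarrow> 'a :: comm_semiring_1"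
  assumes w: "w \<in> Q1 (n + 1)"
  defines "pa \<equiv> \<lambda>j. card {i \<in> proper_at w. j \<noteq> i \<and> j \<noteq> i + 1}"
    and "ip \<equiv> \<lambda>j. card {i \<in> improper_at w. j \<noteq> i \<and> j \<noteq> i + 1}"
    and "bl \<equiv> \<lambda>j. card {i \<in> block2_at w. j \<noteq> i + 1 \<and> j \<noteq> i + 2}"
  shows "(\<Sum>j\<in>{j \<in> {1..2 * n}. odd j = b}. h (pa j + 1) (n - pa j - ip j - bl j) (ip j) (bl j))
    = of_nat (pap w) * h (pap w) (cap n w + 1) (impap w) (bk2 w)
      + of_nat (cap n w) * h (pap w + 1) (cap n w) (impap w) (bk2 w)
      + of_nat (impap w) * h (pap w + 1) (cap n w + 1) (impap w - 1) (bk2 w)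
      + of_nat (bk2 w) * h (pap w + 1) (cap n w + 1) (impap w) (bk2 w - 1)"
proof -
  note L = Q1_length[OF w]
  have N: "nested w" using w by (simp add: Q1_eq)
  define J where "J = {j \<in> {1..2 * n}. odd j = b}"
  \<comment> \<open>Of the gaps \<open>i\<close> and \<open>i + 1\<close>, \<open>g i\<close> is the one with the parity under consideration.\<close>
  define g where "g i = (if odd i = b then i else i + 1)" for i :: nat
  \<comment> \<open>\<open>Suc\<close> appears for blocks since a block at \<open>i\<close> owns the
    gaps \<open>i + 1\<close> and \<open>i + 2\<close>, while a plateau at \<open>i\<close> owns
    \<open>i\<close> and \<open>i + 1\<close>.\<close>
  define E C D A where "E = g ` proper_at w" and "C = g ` improper_at w"
    and "D = (g \<circ> Suc) ` block2_at w" and "A = J - (E \<union> C \<union> D)"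
  have gJ: "g i = j \<longleftrightarrow> j = i \<or> j = i + 1" if "j \<in> J" for i j
    using that by (auto simp: g_def J_def)
  have plat: "g i \<in> J" if "plateau_at w i" for i
  proof -
    have "1 \<le> i" "i + 1 \<le> 2 * n" using that L by (auto simp: plateau_at_def)
    thus ?thesis by (auto simp: g_def J_def)
  qed
  have blk: "g (Suc i) \<in> J" if "i \<in> block2_at w" for i
  proof -
    have "i + 2 \<le> 2 * n" using that L by (auto simp: block2_at_def)
    thus ?thesis by (auto simp: g_def J_def)
  qed
  have g_close: "i = k \<or> i = k + 1 \<or> k = i + 1" if "g i = g k" for i k
    using that by (auto simp: g_def split: if_splits)
  have plat_adj: "\<not> plateau_at w (i + 1)" if "plateau_at w i" for i
    using that by (auto simp: plateau_at_def)
  have inj_p: "inj_on g {i. plateau_at w i}"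
  proof (rule inj_onI)
    fix i k assume "i \<in> {i. plateau_at w i}" "k \<in> {i. plateau_at w i}" "g i = g k"
    thus "i = k" using g_close[of i k] plat_adj[of i] plat_adj[of k] by auto
  qed
  have inj_b: "inj_on (g \<circ> Suc) (block2_at w)"
  proof (rule inj_onI)
    fix i k assume ik: "i \<in> block2_at w" "k \<in> block2_at w" and "(g \<circ> Suc) i = (g \<circ> Suc) k"
    hence "i = k \<or> i = k + 1 \<or> k = i + 1" using g_close[of "Suc i" "Suc k"] by auto
    thus "i = k" using ik by (auto simp: block2_at_def)
  qed
  \<comment> \<open>A plateau starting at the second letter of a block or right after it would need
    a rise that the block excludes; one starting at the first letter needs a smaller predecessor,
    whereas all letters before the block are larger.\<close>
  have dis_b: "g i \<noteq> g (Suc k)" if "plateau_at w i" "k \<in> block2_at w" for i k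
  proof
    assume "g i = g (Suc k)"
    hence "i = k + 1 \<or> i = k + 2 \<or> i = k" using g_close[of i "Suc k"] by auto
    thus False
    proof (elim disjE)
      assume "i = k"
      hence "w ! i < w ! (i - 1)" using that by (auto simp: block2_at_def plateau_at_def)
      thus False using that by (auto simp: plateau_at_def)
    qed (use that in \<open>auto simp: block2_at_def plateau_at_def\<close>)
  qed
  have pi: "proper_at w \<subseteq> {i. plateau_at w i}" "improper_at w \<subseteq> {i. plateau_at w i}"
    "proper_at w \<inter> improper_at w = {}" by (auto simp: proper_at_def improper_at_def)
  have sub: "E \<subseteq> J" "C \<subseteq> J" "D \<subseteq> J" "A \<subseteq> J"
    using pi plat blk by (auto simp: E_def C_def D_def A_def)
  have finJ: "finite J" by (simp add: J_def)
  have fin: "finite E" "finite A" "finite C" "finite D" using finJ sub by (auto intro: finite_subset)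
  have "E \<inter> C = g ` (proper_at w \<inter> improper_at w)"
    unfolding E_def C_def by (rule inj_on_image_Int[OF inj_p pi(1,2), symmetric])
  hence EC: "E \<inter> C = {}" using pi(3) by simp
  have ED: "E \<inter> D = {}" "C \<inter> D = {}" using dis_b pi(1,2) by (auto simp: E_def C_def D_def)
  have dis: "E \<inter> A = {}" "E \<inter> C = {}" "E \<inter> D = {}" "A \<inter> C = {}" "A \<inter> D = {}" "C \<inter> D = {}"
    using EC ED by (auto simp: A_def)
  have U: "J = E \<union> A \<union> C \<union> D" using sub by (auto simp: A_def)
  have cJ: "card J = n" unfolding J_def by (rule card_parity_class)
  have "card J = card E + card A + card C + card D"
    unfolding U using fin dis by (simp add: card_Un_disjoint Int_Un_distrib2)
  hence cA: "card A = n - card E - card C - card D" using cJ by simp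
  have cE: "card E = pap w" "card C = impap w" "card D = bk2 w"
    using card_image[OF inj_on_subset[OF inj_p pi(1)]] card_image[OF inj_on_subset[OF inj_p pi(2)]]
      card_image[OF inj_b] pap_eq[OF N] impap_eq[OF N] bk2_eq[OF w]
    by (simp_all add: E_def C_def D_def)
  have cA': "card A = cap n w" using cA cE by (simp add: cap_def)
  \<comment> \<open>As \<open>J\<close> without \<open>j\<close> has \<open>n - 1\<close> elements,
    subtracting the three remaining classes from \<open>n\<close> leaves one more than the free gaps
    other than \<open>j\<close>. This surplus corresponds to the new anti-excedance.\<close>
  have rem: "pa j = card (E - {j})" "ip j = card (C - {j})" "bl j = card (D - {j})"
    "n - card (E - {j}) - card (C - {j}) - card (D - {j}) = card (A - {j}) + 1" if j: "j \<in> J" for j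
  proof -
    have "{i \<in> proper_at w. j \<noteq> i \<and> j \<noteq> i + 1} = {i \<in> proper_at w. g i \<noteq> j}" using gJ[OF j] by auto
    moreover have "E - {j} = g ` {i \<in> proper_at w. g i \<noteq> j}" by (auto simp: E_def)
    moreover have "inj_on g {i \<in> proper_at w. g i \<noteq> j}" using inj_p pi(1) by (auto intro: inj_on_subset)
    ultimately show 1: "pa j = card (E - {j})" by (simp add: pa_def card_image)
    have "{i \<in> improper_at w. j \<noteq> i \<and> j \<noteq> i + 1} = {i \<in> improper_at w. g i \<noteq> j}" using gJ[OF j] by auto
    moreover have "C - {j} = g ` {i \<in> improper_at w. g i \<noteq> j}" by (auto simp: C_def)
    moreover have "inj_on g {i \<in> improper_at w. g i \<noteq> j}" using inj_p pi(2) by (auto intro: inj_on_subset)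
    ultimately show 2: "ip j = card (C - {j})" by (simp add: ip_def card_image)
    have "{i \<in> block2_at w. j \<noteq> i + 1 \<and> j \<noteq> i + 2} = {i \<in> block2_at w. (g \<circ> Suc) i \<noteq> j}" using gJ[OF j] by auto
    moreover have "D - {j} = (g \<circ> Suc) ` {i \<in> block2_at w. (g \<circ> Suc) i \<noteq> j}" by (auto simp: D_def)
    moreover have "inj_on (g \<circ> Suc) {i \<in> block2_at w. (g \<circ> Suc) i \<noteq> j}" using inj_b by (auto intro: inj_on_subset)
    ultimately show 3: "bl j = card (D - {j})" by (simp only: bl_def card_image)
    have "J - {j} = (E - {j}) \<union> (A - {j}) \<union> (C - {j}) \<union> (D - {j})" unfolding U by blast
    moreover have "(E - {j}) \<inter> (A - {j}) = {}" "((E - {j}) \<union> (A - {j})) \<inter> (C - {j}) = {}"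
      "((E - {j}) \<union> (A - {j}) \<union> (C - {j})) \<inter> (D - {j}) = {}" using dis by auto
    ultimately have "card (J - {j}) = card (E - {j}) + card (A - {j}) + card (C - {j}) + card (D - {j})"
      using fin by (simp only: card_Un_disjoint finite_Diff finite_UnI)
    moreover have "card (J - {j}) + 1 = n" using card_Suc_Diff1[OF finJ j] cJ by simp
    ultimately show "n - card (E - {j}) - card (C - {j}) - card (D - {j}) = card (A - {j}) + 1" by simp
  qed
  have "(\<Sum>j\<in>J. h (pa j + 1) (n - pa j - ip j - bl j) (ip j) (bl j))
    = (\<Sum>j\<in>E \<union> A \<union> C \<union> D. h (card (E - {j}) + 1) (card (A - {j}) + 1) (card (C - {j})) (card (D - {j})))"
    by (intro sum.cong U) (simp only: rem U[symmetric])
  also note sum_remove_from_class[OF fin dis]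
  finally show ?thesis unfolding cE cA' J_def .
qed

lemma sum_insert_pair:
  fixes h :: "nat \<Rightarrow> nat \<Rightarrow> nat \<Rightarrow> nat \<Rightarrow> nat \<Rightarrow> nat \<Rightarrow> 'a :: comm_semiring_1"
  assumes w: "w \<in> Q1 (n + 1)"
  shows "(\<Sum>j\<in>{..2 * n + 1}. let \<sigma> = insert_pair (n + 2) j w in
      h (pap \<sigma>) (cap (n + 1) \<sigma>) (impap \<sigma>) (bk2 \<sigma>) (even_stat \<sigma>) (tr (n + 2) \<sigma>))
    = grow h (pap w) (cap n w) (impap w) (bk2 w) (even_stat w) (tr (n + 1) w)"
proof -
  define F where "F j = (let \<sigma> = insert_pair (n + 2) j w in
      h (pap \<sigma>) (cap (n + 1) \<sigma>) (impap \<sigma>) (bk2 \<sigma>) (even_stat \<sigma>) (tr (n + 2) \<sigma>))" for j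
  note L = Q1_length[OF w]
  have N: "nested w" using w by (simp add: Q1_eq)
  note S = stats_insert_pair[OF w]
  let ?e = "even_stat w" and ?f = "tr (n + 1) w"
  have "{i \<in> proper_at w. 0 \<noteq> i \<and> 0 \<noteq> i + 1} = proper_at w" "{i \<in> improper_at w. 0 \<noteq> i \<and> 0 \<noteq> i + 1} = improper_at w"
    by (auto simp: proper_at_def improper_at_def plateau_at_def)
  \<comment> \<open>\<open>cap\<close> keeps its value because the new block compensates the passage
    from \<open>n\<close> to \<open>n + 1\<close>. This is the summand of a new fixed point.\<close>
  hence F0: "F 0 = h (pap w) (cap n w) (impap w) (bk2 w + 1) ?e (?f + 1)"
    unfolding F_def Let_def cap_def S[OF le0]
    by (simp add: pap_eq[OF N] impap_eq[OF N] bk2_eq[OF w])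
  have "{i \<in> proper_at w. 2 * n + 1 \<noteq> i \<and> 2 * n + 1 \<noteq> i + 1} = proper_at w"
    "{i \<in> improper_at w. 2 * n + 1 \<noteq> i \<and> 2 * n + 1 \<noteq> i + 1} = improper_at w"
    "{i \<in> block2_at w. 2 * n + 1 \<noteq> i + 1 \<and> 2 * n + 1 \<noteq> i + 2} = block2_at w"
    using L by (auto simp: proper_at_def improper_at_def block2_at_def plateau_at_def)
  \<comment> \<open>The index \<open>2 * n + 1\<close> of the last gap is odd, so the new letter
    counts in \<open>even_stat\<close>; this is the summand of a new negative one-element
    cycle.\<close>
  hence FL: "F (2 * n + 1) = h (pap w) (cap n w) (impap w + 1) (bk2 w) (?e + 1) (?f + 1)"
    unfolding F_def Let_def cap_def S[OF order_refl]
    by (simp add: pap_eq[OF N] impap_eq[OF N] bk2_eq[OF w])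
  \<comment> \<open>Odd gaps raise \<open>even_stat\<close> by one, so the two parities supply the
    two values of \<open>k\<close> in \<open>grow\<close>.\<close>
  have interior: "(\<Sum>j\<in>{j \<in> {1..2 * n}. odd j = b}. F j)
    = of_nat (pap w) * h (pap w) (cap n w + 1) (impap w) (bk2 w) (?e + of_bool b) ?f
      + of_nat (cap n w) * h (pap w + 1) (cap n w) (impap w) (bk2 w) (?e + of_bool b) ?f
      + of_nat (impap w) * h (pap w + 1) (cap n w + 1) (impap w - 1) (bk2 w) (?e + of_bool b) ?f
      + of_nat (bk2 w) * h (pap w + 1) (cap n w + 1) (impap w) (bk2 w - 1) (?e + of_bool b) ?f" for b
    unfolding sum_interior_gaps[OF w, of "\<lambda>a b' c d. h a b' c d (?e + of_bool b) ?f" b, symmetric]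
  proof (intro sum.cong refl)
    fix j assume "j \<in> {j \<in> {1..2 * n}. odd j = b}"
    hence j: "j \<le> 2 * n + 1" "0 < j" "j < 2 * n + 1" "odd j = b" by auto
    show "F j = h (card {i \<in> proper_at w. j \<noteq> i \<and> j \<noteq> i + 1} + 1)
        (n - card {i \<in> proper_at w. j \<noteq> i \<and> j \<noteq> i + 1} - card {i \<in> improper_at w. j \<noteq> i \<and> j \<noteq> i + 1}
          - card {i \<in> block2_at w. j \<noteq> i + 1 \<and> j \<noteq> i + 2})
        (card {i \<in> improper_at w. j \<noteq> i \<and> j \<noteq> i + 1}) (card {i \<in> block2_at w. j \<noteq> i + 1 \<and> j \<noteq> i + 2})
        (?e + of_bool b) ?f"
      unfolding F_def Let_def cap_def S[OF j(1)] using j by (simp add: of_bool_def)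
  qed
  show ?thesis
    unfolding F_def[symmetric] sum_parity_split F0 FL interior by (simp add: grow_def add_ac)
qed

section \<open>Equidistribution by induction\<close>

lemma sum_Q1_grow:
  fixes h :: "nat \<Rightarrow> nat \<Rightarrow> nat \<Rightarrow> nat \<Rightarrow> nat \<Rightarrow> nat \<Rightarrow> 'a :: comm_semiring_1"
  shows "(\<Sum>\<sigma>\<in>Q1 (n + 2). h (pap \<sigma>) (cap (n + 1) \<sigma>) (impap \<sigma>) (bk2 \<sigma>) (even_stat \<sigma>) (tr (n + 2) \<sigma>))
    = (\<Sum>w\<in>Q1 (n + 1). grow h (pap w) (cap n w) (impap w) (bk2 w) (even_stat w) (tr (n + 1) w))"
  unfolding sum_Q1_Suc using sum_insert_pair[of _ n h] by (intro sum.cong refl) (simp add: Let_def)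

text \<open>The weight stays arbitrary in the induction because the hypothesis is applied to
  \<open>grow h\<close>. For \<open>n = 0\<close> each side has a single object, all of whose
  statistics vanish.\<close>

lemma stirling_signed_equidistributed:
  fixes h :: "nat \<Rightarrow> nat \<Rightarrow> nat \<Rightarrow> nat \<Rightarrow> nat \<Rightarrow> nat \<Rightarrow> 'a :: comm_semiring_1"
  shows "(\<Sum>\<sigma>\<in>Q1 (n + 1). h (pap \<sigma>) (cap n \<sigma>) (impap \<sigma>) (bk2 \<sigma>) (even_stat \<sigma>) (tr (n + 1) \<sigma>))
    = (\<Sum>\<pi>\<in>signed_perms n. h (exc n \<pi>) (aexc n \<pi>) (single n \<pi>) (fixpts n \<pi>) (neg n \<pi>) (cyc n \<pi>))"
proof (induction n arbitrary: h)
  case 0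
  have "Q1 1 = {[1]}" by (auto simp: Q1_eq nested_def)
  moreover have "proper_at [1] = {}" "improper_at [1] = {}" "block2_at [1] = {}" "even_values [1] = {}"
    by (auto simp: proper_at_def improper_at_def block2_at_def plateau_at_def even_values_def)
  moreover have "nested [1]" "[1] \<in> Q1 1" using \<open>Q1 1 = {[1]}\<close> by (auto simp: nested_def)
  moreover have "tr 1 [1] = 0" by (simp add: tr_def Trace_def)
  moreover have "signed_perms 0 = {id}" by (auto simp: signed_perms_def)
  ultimately show ?case
    by (simp add: pap_eq impap_eq bk2_eq[of _ 1] even_stat_eq cap_def exc_def aexc_def single_def fixpts_def
        neg_def cyc_def)
next
  case (Suc n)
  show ?case
    using sum_Q1_grow[of h n] Suc.IH[of "grow h"] sum_signed_perms_Suc[of h n] by simp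
qed

theorem theorem3p10:
  fixes n :: nat and x y s t p q :: "'a :: comm_ring_1"
  assumes "n \<ge> 1"
  shows "(\<Sum>\<sigma> \<in> Q1 (n + 1).
            x ^ pap \<sigma> * y ^ cap n \<sigma> * s ^ impap \<sigma> * t ^ bk2 \<sigma> * p ^ even_stat \<sigma> * q ^ tr (n + 1) \<sigma>)
       = (\<Sum>\<pi> \<in> signed_perms n.
            x ^ exc n \<pi> * y ^ aexc n \<pi> * s ^ single n \<pi> * t ^ fixpts n \<pi> * p ^ neg n \<pi> * q ^ cyc n \<pi>)"
  by (rule stirling_signed_equidistributed[of "\<lambda>a b c d e f. x ^ a * y ^ b * s ^ c * t ^ d * p ^ e * q ^ f"])

end
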